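(* For all integers $n,k,i,j\ge 0$ let $\overline{C}_1(n;k;i,j)$ denote the number of jagged overpartitions of $n$ (as defined in the context) with exactly $k$ non-overlined parts, exactly $i$ parts of color $a$ and exactly $j$ parts of color $b$, satisfying the additional condition: if the smallest $u$-colored part $x_u$ is equal to the number of overlined parts which come after $x_u$ (with $x_u$ included), then the final part $\lambda_s$ must be overlined. Then, as formal power series, $$\sum_{n,k,i,j \geq 0} \overline{C}_1(n;k;i,j) a^ib^jd^kq^n = \frac{(-q;q)_{\infty}}{(dq;q)_{\infty}} \sum_{r,s \geq 0} \frac{q^{r^2+r+s^2+s - \binom{r+s+1}{2}} a^rb^s d^{r+s} (-q/d;q)_{r+s}}{(q^2;q^2)_r(q^2;q^2)_s}.$$
   Context: Notation: $(x;q)_n=\prod_{m=0}^{n-1}(1-xq^m)$ for $n\in\mathbb{N}\cup\{\infty\}$. A jagged overpartition of $n$ is a finite sequence $(\lambda_1,\dots,\lambda_s)$ of non-negative integers with sum $n$, where each part carries one of three colors $a$, $b$, $u$, the final occurrence of a positive part may be overlined (zero parts are never overlined), the last part satisfies $\lambda_s\notin\{0_a,0_b,\overline{1}_a,\overline{1}_b\}$, and for each $i$ the difference $\lambda_i-\lambda_{i+1}$ is at least the entry of the following matrix in the row given by the type of $\lambda_i$ and the column given by the type of $\lambda_{i+1}$ (types: $\overline{a},\overline{b},\overline{u}$ for overlined parts of colors $a,b,u$; $a,b,u$ for non-overlined ones), columns in the order $\overline{a},\overline{b},\overline{u},a,b,u$: row $\overline{a}$: $2,0,2,2,0,2$; row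 $\overline{b}$: $2,2,3,2,2,3$; row $\overline{u}$: $1,0,1,1,0,1$; row $a$: $1,-1,1,1,-1,1$; row $b$: $1,1,2,1,1,2$; row $u$: $0,-1,0,0,-1,0$. (For example $(4_a,\overline{5}_b,2_u,2_u,\overline{2}_u,1_u,2_b,1_a)$ is such a jagged overpartition.) Non-overlined parts include parts equal to $0$. *)

theory Defs
  imports
    "HOL-Analysis.Analysis"
    "HOL-Computational_Algebra.Formal_Laurent_Series"
begin

datatype colour = ColA | ColB | ColU

datatype part = Part (pval: nat) (pcol: colour) (overlined: bool)

fun type_index :: "part \<Rightarrow> nat" where
  "type_index (Part v ColA True) = 0"
| "type_index (Part v ColB True) = 1"
| "type_index (Part v ColU True) = 2"
| "type_index (Part v ColA False) = 3"
| "type_index (Part v ColB False) = 4"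
| "type_index (Part v ColU False) = 5"

definition diff_matrix :: "int list list" where
  "diff_matrix =
    [[2,  0, 2, 2,  0, 2],
     [2,  2, 3, 2,  2, 3],
     [1,  0, 1, 1,  0, 1],
     [1, -1, 1, 1, -1, 1],
     [1,  1, 2, 1,  1, 2],
     [0, -1, 0, 0, -1, 0]]"

definition min_diff :: "part \<Rightarrow> part \<Rightarrow> int" where
  "min_diff x y = diff_matrix ! type_index x ! type_index y"

text \<open>Only the last occurrence of a part may be overlined; parts of equal value but different
  colour are different parts, so an overlined 2 of colour u may precede a 2 of colour b.\<close>

definition jagged_overpartition :: "part list \<Rightarrow> bool" where
  "jagged_overpartition xs \<longleftrightarrow>
     (\<forall>p < length xs. overlined (xs ! p) \<longrightarrow>
        pval (xs ! p) > 0 \<and>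
        (\<forall>p'. p < p' \<and> p' < length xs \<longrightarrow>
           \<not> (pval (xs ! p') = pval (xs ! p) \<and> pcol (xs ! p') = pcol (xs ! p)))) \<and>
     (xs \<noteq> [] \<longrightarrow> last xs \<notin>
        {Part 0 ColA False, Part 0 ColB False, Part 1 ColA True, Part 1 ColB True}) \<and>
     (\<forall>p. Suc p < length xs \<longrightarrow>
        int (pval (xs ! p)) - int (pval (xs ! Suc p)) \<ge> min_diff (xs ! p) (xs ! Suc p))"

definition smallest_u_at :: "part list \<Rightarrow> nat \<Rightarrow> bool" where
  "smallest_u_at xs p \<longleftrightarrow> p < length xs \<and> pcol (xs ! p) = ColU \<and>
     (\<forall>p' < length xs. pcol (xs ! p') = ColU \<longrightarrow> pval (xs ! p) \<le> pval (xs ! p'))"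

text \<open>The smallest value of a u-coloured part may occur several times. In a jagged overpartition
  its occurrences are consecutive and only the last of them can be overlined, so the number of
  overlined parts from \<open>p\<close> onwards does not depend on the occurrence chosen. The condition is
  vacuous if there is no u-coloured part.\<close>

definition u_condition :: "part list \<Rightarrow> bool" where
  "u_condition xs \<longleftrightarrow>
     (\<forall>p. smallest_u_at xs p \<and>
          pval (xs ! p) = card {p'. p \<le> p' \<and> p' < length xs \<and> overlined (xs ! p')}
          \<longrightarrow> overlined (last xs))"

text \<open>The set below is finite: overlined parts are positive, so a sequence in it has at most \<open>n + k\<close>
  parts, each at most \<open>n\<close>.\<close>

definition C1 :: "nat \<Rightarrow> nat \<Rightarrow> nat \<Rightarrow> nat \<Rightarrow> nat" where
  "C1 n k i j = card {xs. jagged_overpartition xs \<and> u_condition xs \<and>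
     sum_list (map pval xs) = n \<and>
     length (filter (\<lambda>x. \<not> overlined x) xs) = k \<and>
     length (filter (\<lambda>x. pcol x = ColA) xs) = i \<and>
     length (filter (\<lambda>x. pcol x = ColB) xs) = j}"

definition qpoch :: "'a::comm_ring_1 \<Rightarrow> 'a \<Rightarrow> nat \<Rightarrow> 'a" where
  "qpoch x q n = (\<Prod>m<n. 1 - x * q ^ m)"

definition qpoch_inf :: "'a::{t2_space, comm_ring_1} \<Rightarrow> 'a \<Rightarrow> 'a" where
  "qpoch_inf x q = (\<Prod>m. 1 - x * q ^ m)"

text \<open>The generating functions are power series in \<open>q\<close> whose coefficients are iterated formal
  Laurent series in the indeterminates \<open>a\<close>, \<open>b\<close>, \<open>d\<close> (from the innermost to the outermost); this
  coefficient field is needed because \<open>-q/d\<close> occurs. Infinite sums and products are taken in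
  the topology of the type \<open>fps\<close>, which is the \<open>q\<close>-adic one. The coefficients are discrete for this
  topology: a family of monomials is summable only if each power of \<open>q\<close> occurs in finitely many
  of its nonzero members.\<close>

type_synonym gf = "rat fls fls fls fps"

definition var_a :: gf where "var_a = fps_const (fls_const (fls_const fls_X))"
definition var_b :: gf where "var_b = fps_const (fls_const fls_X)"
definition var_d :: gf where "var_d = fps_const fls_X"
definition var_q :: gf where "var_q = fps_X"

end

(* Subtracting from every part the number of overlined parts from its position onwards, and 1 if
   its colour is b, splits a jagged overpartition with s parts into a coloured partition with
   non-negative minimal differences and an arbitrary choice of overlined positions; the latter
   contributes W_s = prod_{p=1..s} (d + q^p). The condition on the smallest u-coloured part becomes:
   if the coloured partition has a part 0_u, then the last part is overlined. Let P_s be the generating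
   function of the coloured partitions with s parts, r of colour a and t of colour b. Removing one 0_u
   shows that those with a part 0_u and s parts are counted by P_{s-1}, so the objects with s parts are
   counted by W_s P_s - d W_{s-1} P_{s-1}.

   Removing the last part gives a linear recursion for P_s and its variants for other end conditions,
   solved by products: with N = r + t and e = r^2 + r + t^2 + t - binomial(N + 1, 2),
     P_s = q^e (-q;q)_N / ((q;q)_{s-N} (q^2;q^2)_r (q^2;q^2)_t).
   The sum over s is then an instance of the q-binomial theorem. *)
theory Submission
  imports Defs
begin

section \<open>A \<open>q\<close>-adic \<open>q\<close>-binomial theorem\<close>

lemma fps_X_power_dvd_iff:
  fixes f :: "'a::field fps"
  shows "fps_X ^ n dvd f \<longleftrightarrow> (\<forall>i<n. fps_nth f i = 0)"
proof
  assume "fps_X ^ n dvd f"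
  then show "\<forall>i<n. fps_nth f i = 0"
    by (auto simp: fps_X_power_mult_nth elim!: dvdE)
next
  assume "\<forall>i<n. fps_nth f i = 0"
  then have "f = fps_X ^ n * fps_shift n f"
    by (auto simp: fps_eq_iff fps_X_power_mult_nth)
  then show "fps_X ^ n dvd f" by (metis dvd_triv_left)
qed

text \<open>The \<open>q\<close>-adic topology is separated: this turns the congruences that stand
  in for limits below back into equalities.\<close>

lemma fps_eqI_cong:
  fixes f g :: "'a::field fps"
  assumes "\<And>n. fps_X ^ n dvd f - g"
  shows "f = g"
  using assms[of "Suc _"] unfolding fps_X_power_dvd_iff by (force simp: fps_eq_iff)

lemma dvd_diff_mult:
  fixes x :: "'a::comm_ring_1"
  assumes "x dvd f - f'" "x dvd g - g'"
  shows "x dvd f * g - f' * g'"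
proof -
  have "f * g - f' * g' = (f - f') * g + f' * (g - g')" by (simp add: algebra_simps)
  then show ?thesis using assms by (metis dvd_add dvd_mult dvd_mult2)
qed

lemma dvd_diff_trans:
  fixes x :: "'a::comm_ring_1"
  assumes "x dvd f - g" "x dvd g - h"
  shows "x dvd f - h"
  using dvd_add[OF assms] by simp

section \<open>Stabilisation of q-Pochhammer products\<close>

lemma qpoch_0 [simp]: "qpoch x q 0 = 1"
  by (simp add: qpoch_def)

lemma qpoch_Suc: "qpoch x q (Suc n) = qpoch x q n * (1 - x * q ^ n)"
  by (simp add: qpoch_def)

lemma qpoch_add: "qpoch x q (m + n) = qpoch x q m * qpoch (x * q ^ m) q n"
  by (induction n) (simp_all add: qpoch_Suc power_add algebra_simps)

lemma qpoch_nth_0: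
  fixes x :: "'a::field fps"
  assumes "fps_X dvd x"
  shows "fps_nth (qpoch x q n) 0 = 1"
proof -
  have "fps_nth x 0 = 0" using assms fps_X_power_dvd_iff[of 1 x] by simp
  then show ?thesis by (induction n) (simp_all add: qpoch_Suc)
qed

text \<open>Each factor beyond the first \<open>n\<close> differs from 1 by a multiple of
  \<open>x * fps_X ^ n\<close>, and \<open>x\<close> supplies one more power of
  \<open>fps_X\<close>.\<close>

lemma qpoch_cong:
  fixes x :: "'a::field fps"
  assumes "fps_X dvd x" "n \<le> m"
  shows "fps_X ^ Suc n dvd qpoch x fps_X m - qpoch x fps_X n"
  using assms(2)
proof (induction m rule: dec_induct)
  case (step k)
  have "fps_X ^ Suc n dvd fps_X * fps_X ^ k"
    using step.hyps by (metis Suc_le_mono le_imp_power_dvd nat_less_le power_Suc)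
  also have "\<dots> dvd x * fps_X ^ k" using assms(1) by (simp add: mult_dvd_mono)
  also have "\<dots> dvd qpoch x fps_X (Suc k) - qpoch x fps_X k"
    by (simp add: qpoch_Suc algebra_simps)
  finally show ?case using step.IH by (rule dvd_diff_trans)
qed simp

lemma qpoch_inf_cong:
  fixes x :: "'a::field fps"
  assumes "fps_X dvd x"
  shows "fps_X ^ n dvd qpoch_inf x fps_X - qpoch x fps_X n"
proof -
  \<comment> \<open>The \<open>i\<close>-th coefficient is read off the \<open>i\<close>-th partial
    product, where it has already stabilised.\<close>
  define S where "S = Abs_fps (\<lambda>i. fps_nth (qpoch x fps_X i) i)"
  have eq: "fps_nth (qpoch x fps_X m) i = fps_nth S i" if "i \<le> m" for m i
  proof -
    from qpoch_cong[OF assms that]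
    have "fps_nth (qpoch x fps_X m) i - fps_nth (qpoch x fps_X i) i = 0"
      unfolding fps_X_power_dvd_iff by auto
    then show ?thesis by (simp add: S_def)
  qed
  have "(\<lambda>m. \<Prod>i\<le>m. 1 - x * fps_X ^ i) \<longlonglongrightarrow> S"
  proof (rule tendsto_fpsI)
    fix i
    show "\<forall>\<^sub>F m in sequentially. fps_nth (\<Prod>i\<le>m. 1 - x * fps_X ^ i) i = fps_nth S i"
      using eventually_ge_at_top[of i]
    proof eventually_elim
      case (elim m)
      then show ?case using eq[of i "Suc m"] by (simp add: qpoch_def lessThan_Suc_atMost)
    qed
  qed
  \<comment> \<open>Convergence of an infinite product in the sense of \<open>has_prod\<close>
    requires a nonzero limit.\<close>
  moreover have "S \<noteq> 0" using qpoch_nth_0[OF assms, of fps_X 0] eq[of 0 0] by auto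
  ultimately have "(\<lambda>i. 1 - x * fps_X ^ i) has_prod S"
    by (simp add: has_prod_def raw_has_prod_def)
  then have "qpoch_inf x fps_X = S"
    unfolding qpoch_inf_def by (rule has_prod_unique[symmetric])
  then show ?thesis using eq by (auto simp: fps_X_power_dvd_iff)
qed

text \<open>The partial sums satisfy the functional equation of the \<open>q\<close>-binomial series
  \<open>\<Sum>m. (-q^N/d; q)\<^sub>m (d q^k)^m / (q; q)\<^sub>m\<close> up to a boundary term; iterating it moves
  \<open>k\<close> to infinity, where only the summand \<open>m = 0\<close> survives.\<close>

definition qbin_term :: "'a::field \<Rightarrow> nat \<Rightarrow> nat \<Rightarrow> 'a fps" where
  "qbin_term d N m = (\<Prod>p<m. fps_const d + fps_X ^ (N + p)) * inverse (qpoch fps_X fps_X m)"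

definition qbin_sum :: "'a::field \<Rightarrow> nat \<Rightarrow> nat \<Rightarrow> nat \<Rightarrow> 'a fps" where
  "qbin_sum d N k L = (\<Sum>m\<le>L. fps_X ^ (k * m) * qbin_term d N m)"

lemma qbin_term_Suc:
  "qbin_term d N (Suc m) * (1 - fps_X ^ Suc m) = qbin_term d N m * (fps_const d + fps_X ^ (N + m))"
proof -
  have "inverse (qpoch fps_X fps_X (Suc m)) * (1 - fps_X ^ Suc m) =
        inverse (qpoch (fps_X :: 'a fps) fps_X m)"
    by (simp add: qpoch_Suc fps_inverse_mult mult.assoc inverse_mult_eq_1)
  then show ?thesis
    by (simp only: qbin_term_def prod.lessThan_Suc mult.assoc) (simp only: mult_ac)
qed

lemma qbin_sum_step:
  assumes "k > 0"
  shows "fps_X ^ Suc L dvd (1 - fps_const d * fps_X ^ k) * qbin_sum d N k L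
           - (1 + fps_X ^ (N + k)) * qbin_sum d N (Suc k) L"
proof -
  let ?t = "qbin_term d N" and ?S = "qbin_sum d N" and ?d = "fps_const d"
  \<comment> \<open>The difference of two summands carries the factor \<open>1 - fps_X ^ m\<close>,
    which kills \<open>m = 0\<close> and otherwise cancels the last factor of the denominator of
    \<open>?t m\<close>. After the shift of \<open>m\<close> both sums reappear on the
    right.\<close>
  have "?S k L - ?S (Suc k) L = (\<Sum>m\<le>L. fps_X ^ (k * m) * (?t m * (1 - fps_X ^ m)))"
    by (simp add: qbin_sum_def sum_subtractf[symmetric] power_add algebra_simps)
  also have "\<dots> = (\<Sum>m<L. fps_X ^ (k * Suc m) * (?t (Suc m) * (1 - fps_X ^ Suc m)))"
    by (subst sum.atMost_shift) simp
  also have "\<dots> = (\<Sum>m<L. fps_X ^ (k * Suc m) * (?t m * (?d + fps_X ^ (N + m))))"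
    by (simp only: qbin_term_Suc)
  also have "\<dots> = ?d * fps_X ^ k * (\<Sum>m<L. fps_X ^ (k * m) * ?t m) +
      fps_X ^ (N + k) * (\<Sum>m<L. fps_X ^ (Suc k * m) * ?t m)"
    by (simp add: sum_distrib_left sum.distrib[symmetric] power_add algebra_simps)
  also have "\<dots> = ?d * fps_X ^ k * (?S k L - fps_X ^ (k * L) * ?t L) +
      fps_X ^ (N + k) * (?S (Suc k) L - fps_X ^ (Suc k * L) * ?t L)"
    by (simp add: qbin_sum_def lessThan_Suc_atMost[symmetric])
  finally have "(1 - ?d * fps_X ^ k) * ?S k L - (1 + fps_X ^ (N + k)) * ?S (Suc k) L =
     - (fps_X ^ (k * Suc L)) * (?t L * (?d + fps_X ^ (N + L)))"
    by (simp add: power_add algebra_simps)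
  \<comment> \<open>The boundary term is divisible by \<open>fps_X ^ (k * Suc L)\<close>; here
    \<open>k > 0\<close> enters.\<close>
  moreover have "Suc L \<le> k * Suc L" using assms by (cases k) auto
  ultimately show ?thesis by (metis dvd_minus_iff dvd_mult2 le_imp_power_dvd)
qed

text \<open>Truncated form of the \<open>q\<close>-binomial theorem with argument \<open>dq\<close>
  and numerator parameter \<open>-q^N/d\<close>, multiplied by the denominator of its product
  side.\<close>

lemma qbinomial_cong:
  "fps_X ^ Suc L dvd qpoch (fps_const d * fps_X) fps_X L * qbin_sum d N 1 L
     - qpoch (- (fps_X ^ Suc N)) fps_X L"
proof -
  let ?S = "qbin_sum d N"
  \<comment> \<open>\<open>k\<close> counts the applications of the functional equation; the
    instance used in the end is \<open>k = L\<close>.\<close>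
  have "fps_X ^ Suc L dvd qpoch (fps_const d * fps_X) fps_X k * ?S 1 L
     - qpoch (- (fps_X ^ Suc N)) fps_X k * ?S (Suc k) L" for k
  proof (induction k)
    case (Suc k)
    have "fps_X ^ Suc L dvd (1 - fps_const d * fps_X ^ Suc k) *
        (qpoch (fps_const d * fps_X) fps_X k * ?S 1 L - qpoch (- (fps_X ^ Suc N)) fps_X k * ?S (Suc k) L)"
      using Suc.IH by (rule dvd_mult)
    moreover have "fps_X ^ Suc L dvd qpoch (- (fps_X ^ Suc N)) fps_X k *
        ((1 - fps_const d * fps_X ^ Suc k) * ?S (Suc k) L
           - (1 + fps_X ^ (N + Suc k)) * ?S (Suc (Suc k)) L)"
      by (rule dvd_mult[OF qbin_sum_step]) simp
    ultimately show ?case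
      by (rule dvd_add[THEN dvd_trans]) (simp add: qpoch_Suc power_add algebra_simps)
  qed simp
  moreover have "fps_X ^ Suc L dvd ?S (Suc L) L - 1"
  proof -
    have "?S (Suc L) L - 1 = (\<Sum>m<L. fps_X ^ (Suc L * Suc m) * qbin_term d N (Suc m))"
      unfolding qbin_sum_def by (subst sum.atMost_shift) (simp add: qbin_term_def)
    also have "fps_X ^ Suc L dvd \<dots>"
      by (intro dvd_sum dvd_mult2 le_imp_power_dvd) simp
    finally show ?thesis .
  qed
  then have "fps_X ^ Suc L dvd qpoch (- (fps_X ^ Suc N)) fps_X L * ?S (Suc L) L
     - qpoch (- (fps_X ^ Suc N)) fps_X L * 1"
    by (intro dvd_diff_mult) auto
  ultimately show ?thesis by (auto intro: dvd_diff_trans)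
qed

section \<open>Weighted counting\<close>

text \<open>\<open>w\<close> is the exponent of \<open>q\<close>, \<open>c\<close> the remaining
  weight. An infinite fibre of \<open>w\<close> would give the default value 0 of an infinite sum,
  hence the finiteness hypotheses in \<open>genfun_Un\<close> and
  \<open>genfun_Times\<close>.\<close>

definition genfun :: "'b set \<Rightarrow> ('b \<Rightarrow> nat) \<Rightarrow> ('b \<Rightarrow> 'a) \<Rightarrow> 'a::comm_ring_1 fps" where
  "genfun S w c = Abs_fps (\<lambda>n. \<Sum>x | x \<in> S \<and> w x = n. c x)"

lemma genfun_nth: "fps_nth (genfun S w c) n = (\<Sum>x | x \<in> S \<and> w x = n. c x)"
  by (simp add: genfun_def)

lemma genfun_empty [simp]: "genfun {} w c = 0"
  by (simp add: fps_eq_iff genfun_nth)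

lemma genfun_cong:
  assumes "S = S'" "\<And>x. x \<in> S' \<Longrightarrow> w x = w' x" "\<And>x. x \<in> S' \<Longrightarrow> c x = c' x"
  shows "genfun S w c = genfun S' w' c'"
  unfolding fps_eq_iff genfun_nth using assms by (intro allI sum.cong) auto

lemma genfun_Un:
  assumes "\<And>n. finite {x \<in> S. w x = n}" "\<And>n. finite {x \<in> T. w x = n}" "S \<inter> T = {}"
  shows "genfun (S \<union> T) w c = genfun S w c + genfun T w c"
proof -
  have "{x. x \<in> S \<union> T \<and> w x = n} = {x \<in> S. w x = n} \<union> {x \<in> T. w x = n}" for n by auto
  moreover have "{x \<in> S. w x = n} \<inter> {x \<in> T. w x = n} = {}" for n using assms(3) by auto
  ultimately show ?thesis
    by (simp add: fps_eq_iff genfun_nth sum.union_disjoint assms)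
qed

lemma genfun_reindex:
  assumes "inj_on f S"
  shows "genfun (f ` S) w c = genfun S (w \<circ> f) (c \<circ> f)"
proof -
  have "{y. y \<in> f ` S \<and> w y = n} = f ` {x. x \<in> S \<and> w (f x) = n}" for n by auto
  moreover have "inj_on f {x. x \<in> S \<and> w (f x) = n}" for n
    using assms by (rule inj_on_subset) auto
  ultimately show ?thesis by (simp add: fps_eq_iff genfun_nth sum.reindex)
qed

lemma genfun_Times:
  assumes "\<And>n. finite {x \<in> S. w x = n}" "\<And>n. finite {x \<in> T. v x = n}"
  shows "genfun (S \<times> T) (\<lambda>(x, y). w x + v y) (\<lambda>(x, y). c x * e y) = genfun S w c * genfun T v e"
proof (rule fps_ext)
  fix n
  let ?A = "\<lambda>i. {x. x \<in> S \<and> w x = i} \<times> {y. y \<in> T \<and> v y = n - i}"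
  have "{p. p \<in> S \<times> T \<and> (case p of (x, y) \<Rightarrow> w x + v y) = n} = (\<Union>i\<in>{0..n}. ?A i)"
    by (auto; presburger)
  then have "fps_nth (genfun (S \<times> T) (\<lambda>(x, y). w x + v y) (\<lambda>(x, y). c x * e y)) n
      = (\<Sum>p\<in>(\<Union>i\<in>{0..n}. ?A i). case p of (x, y) \<Rightarrow> c x * e y)"
    by (simp add: genfun_nth)
  also have "\<dots> = (\<Sum>i=0..n. \<Sum>p\<in>?A i. case p of (x, y) \<Rightarrow> c x * e y)"
    by (rule sum.UNION_disjoint) (use assms in auto)
  also have "\<dots> = (\<Sum>i=0..n. fps_nth (genfun S w c) i * fps_nth (genfun T v e) (n - i))"
    by (simp add: genfun_nth sum_product sum.cartesian_product)
  finally show "fps_nth (genfun (S \<times> T) (\<lambda>(x, y). w x + v y) (\<lambda>(x, y). c x * e y)) n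
      = fps_nth (genfun S w c * genfun T v e) n"
    by (simp add: fps_mult_nth)
qed

lemma genfun_add_weight:
  "genfun S (\<lambda>x. w x + k) c = fps_X ^ k * genfun S w c"
proof (rule fps_ext)
  fix n
  show "fps_nth (genfun S (\<lambda>x. w x + k) c) n = fps_nth (fps_X ^ k * genfun S w c) n"
  proof (cases "n < k")
    case False
    then have "{x \<in> S. w x + k = n} = {x \<in> S. w x = n - k}" by auto
    with False show ?thesis by (simp add: genfun_nth fps_X_power_mult_nth)
  qed (simp add: genfun_nth fps_X_power_mult_nth)
qed

lemma genfun_mult_const:
  "genfun S w (\<lambda>x. k * c x) = fps_const k * genfun S w c"
  by (simp add: fps_eq_iff genfun_nth sum_distrib_left)

section \<open>Coloured partitions\<close>

definition gap :: "colour \<Rightarrow> colour \<Rightarrow> nat" where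
  "gap c c' = (if (c = ColA \<and> c' \<noteq> ColB) \<or> (c = ColB \<and> c' \<noteq> ColA) then 1 else 0)"

definition is_b :: "colour \<Rightarrow> nat" where
  "is_b c = (if c = ColB then 1 else 0)"

text \<open>A list ends with a virtual part of value \<open>0\<close> and colour \<open>e\<close>, which makes the removal of the last
  part recursive in \<open>e\<close>. The condition on the last part of a jagged overpartition is the case
  \<open>e = ColA\<close>.\<close>

fun first :: "colour \<Rightarrow> (nat \<times> colour) list \<Rightarrow> nat \<times> colour" where
  "first e [] = (0, e)"
| "first e (x # xs) = x"

fun cpart :: "colour \<Rightarrow> (nat \<times> colour) list \<Rightarrow> bool" where
  "cpart e [] \<longleftrightarrow> True"
| "cpart e (x # xs) \<longleftrightarrow> fst (first e xs) + gap (snd x) (snd (first e xs)) \<le> fst x \<and> cpart e xs"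

text \<open>The extra \<open>is_b\<close> restores the 1 that was subtracted from parts of colour b,
  so that this is the contribution to the sum of the original overpartition apart from the
  overlining.\<close>

definition cweight :: "(nat \<times> colour) list \<Rightarrow> nat" where
  "cweight xs = (\<Sum>x\<leftarrow>xs. fst x + is_b (snd x))"

definition ccount :: "colour \<Rightarrow> (nat \<times> colour) list \<Rightarrow> nat" where
  "ccount c xs = length (filter (\<lambda>x. snd x = c) xs)"

definition cparts :: "colour \<Rightarrow> nat \<Rightarrow> nat \<Rightarrow> nat \<Rightarrow> (nat \<times> colour) list set" where
  "cparts e s r t = {xs. cpart e xs \<and> length xs = s \<and> ccount ColA xs = r \<and> ccount ColB xs = t}"

lemma finite_lists_bounded:
  "finite {xs :: (nat \<times> colour) list. length xs = s \<and> cweight xs = n}"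
proof (rule finite_subset)
  have "set xs \<subseteq> {..cweight xs} \<times> {ColA, ColB, ColU}" for xs
  proof (induction xs)
    case (Cons x xs)
    then show ?case by (cases x; cases "snd x") (fastforce simp: cweight_def)+
  qed simp
  then show "{xs. length xs = s \<and> cweight xs = n} \<subseteq>
      {xs. set xs \<subseteq> {..n} \<times> {ColA, ColB, ColU} \<and> length xs = s}"
    by blast
qed (simp add: finite_lists_length_eq)

lemma finite_cparts: "finite {xs \<in> cparts e s r t. cweight xs = n}"
  by (rule finite_subset[OF _ finite_lists_bounded[of s n]]) (auto simp: cparts_def)

section \<open>Removal of the last part\<close>

definition lift :: "nat \<Rightarrow> (nat \<times> colour) list \<Rightarrow> (nat \<times> colour) list" where
  "lift v xs = map (\<lambda>(u, c). (u + v, c)) xs"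

lemma length_lift [simp]: "length (lift v xs) = length xs"
  by (simp add: lift_def)

lemma first_lift_snoc:
  "first e (lift v xs @ [(v, c)]) = (fst (first c xs) + v, snd (first c xs))"
  by (cases xs) (auto simp: lift_def)

text \<open>Subtracting the last value \<open>v\<close> from all parts turns the last part into the
  virtual end part of value 0 and colour \<open>c\<close>. Differences are unchanged, so only the
  gap from \<open>c\<close> to the old end colour bounds \<open>v\<close>.\<close>

lemma cpart_lift_snoc: "cpart e (lift v xs @ [(v, c)]) \<longleftrightarrow> cpart c xs \<and> gap c e \<le> v"
proof (induction xs)
  case (Cons x xs)
  have *: "lift v (x # xs) @ [(v, c)] = (fst x + v, snd x) # (lift v xs @ [(v, c)])"
    by (cases x) (simp add: lift_def)
  show ?case unfolding * cpart.simps first_lift_snoc Cons.IH by auto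
qed (simp add: lift_def)

lemma cpart_first_ge: "cpart e xs \<Longrightarrow> x \<in> set xs \<Longrightarrow> fst x \<le> fst (first e xs)"
proof (induction xs)
  case (Cons y xs)
  then show ?case by (cases "x = y") auto
qed simp

lemma cpart_snoc_ge:
  "cpart e (xs @ [(v, c)]) \<Longrightarrow> x \<in> set xs \<Longrightarrow> v \<le> fst x"
proof (induction xs)
  case (Cons y xs)
  then show ?case using cpart_first_ge[of e "xs @ [(v, c)]" "(v, c)"] by fastforce
qed simp

lemma cpart_snocE:
  assumes "cpart e (ys @ [(v, c)])"
  obtains xs where "ys = lift v xs"
proof
  \<comment> \<open>The last value is the smallest one, so the truncated subtraction loses
    nothing.\<close>
  show "ys = lift v (map (\<lambda>(u, c). (u - v, c)) ys)"
    using cpart_snoc_ge[OF assms] by (auto simp: lift_def o_def intro!: map_idI[symmetric])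
qed

lemma ccount_lift_snoc:
  "ccount c' (lift v xs @ [(v, c)]) = ccount c' xs + (if c = c' then 1 else 0)"
  by (simp add: ccount_def lift_def filter_map o_def case_prod_unfold)

lemma cweight_lift_snoc:
  "cweight (lift v xs @ [(v, c)]) = Suc (length xs) * v + is_b c + cweight xs"
proof (induction xs)
  case (Cons x xs)
  then show ?case by (cases x) (simp add: cweight_def lift_def)
qed (simp add: cweight_def lift_def)

text \<open>The counts \<open>r\<close> and \<open>t\<close> refer to the list with its last part of
  colour \<open>c\<close> put back. Stating them as sums makes the set empty, rather than wrong,
  when \<open>r\<close> or \<open>t\<close> is too small.\<close>

definition cpred :: "colour \<Rightarrow> nat \<Rightarrow> nat \<Rightarrow> nat \<Rightarrow> (nat \<times> colour) list set" where
  "cpred c s r t = {xs. cpart c xs \<and> length xs = s \<and>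
     ccount ColA xs + (if c = ColA then 1 else 0) = r \<and> ccount ColB xs + is_b c = t}"

lemma cpred_simps:
  "cpred ColA s 0 t = {}" "cpred ColA s (Suc r) t = cparts ColA s r t"
  "cpred ColB s r 0 = {}" "cpred ColB s r (Suc t) = cparts ColB s r t"
  "cpred ColU s r t = cparts ColU s r t"
  by (auto simp: cpred_def cparts_def is_b_def)

definition csnoc :: "colour \<Rightarrow> nat \<times> (nat \<times> colour) list \<Rightarrow> (nat \<times> colour) list" where
  "csnoc c = (\<lambda>(v, xs). lift v xs @ [(v, c)])"

lemma lift_inject: "lift v xs = lift v ys \<longleftrightarrow> xs = ys"
  unfolding lift_def by (rule inj_map_eq_map) (auto intro: injI)

lemma inj_csnoc: "inj_on (csnoc c) S"
  by (auto simp: inj_on_def csnoc_def lift_inject)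

lemma cparts_Suc:
  "cparts e (Suc s) r t = (\<Union>c\<in>{ColA, ColB, ColU}. csnoc c ` ({gap c e..} \<times> cpred c s r t))"
proof (intro equalityI subsetI)
  fix xs assume xs: "xs \<in> cparts e (Suc s) r t"
  then obtain ys v c where ys: "xs = ys @ [(v, c)]"
    by (auto simp: cparts_def length_Suc_conv_rev)
  with xs obtain zs where "ys = lift v zs"
    by (auto simp: cparts_def elim: cpart_snocE)
  with xs ys have "xs = csnoc c (v, zs)" "(v, zs) \<in> {gap c e..} \<times> cpred c s r t"
    by (auto simp: cparts_def cpred_def csnoc_def cpart_lift_snoc ccount_lift_snoc is_b_def)
  moreover have "c \<in> {ColA, ColB, ColU}" by (cases c) auto
  ultimately show "xs \<in> (\<Union>c\<in>{ColA, ColB, ColU}. csnoc c ` ({gap c e..} \<times> cpred c s r t))"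
    by blast
qed (auto simp: cparts_def cpred_def csnoc_def cpart_lift_snoc ccount_lift_snoc is_b_def)

section \<open>The linear recursion for the generating functions\<close>

lemma genfun_geometric:
  "(1 - fps_X ^ Suc s) * genfun {k..} (\<lambda>v. Suc s * v) (\<lambda>_. 1) = (fps_X ^ (Suc s * k) :: 'a::comm_ring_1 fps)"
proof -
  have fin: "finite {x \<in> A. Suc s * x = n}" for A n
    by (rule finite_subset[of _ "{..n}"]) auto
  let ?G = "\<lambda>k. genfun {k..} (\<lambda>v. Suc s * v) (\<lambda>_. 1 :: 'a)"
  have "?G (Suc k) = genfun (Suc ` {k..}) (\<lambda>v. Suc s * v) (\<lambda>_. 1)"
    proof -
    have "{Suc k..} = Suc ` {k..}"
    proof (intro equalityI subsetI)
      fix x assume "x \<in> {Suc k..}"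
      then show "x \<in> Suc ` {k..}" by (intro image_eqI[of _ _ "x - 1"]) auto
    qed auto
    then show ?thesis by simp
  qed
  also have "\<dots> = genfun {k..} (\<lambda>v. Suc s * v + Suc s) (\<lambda>_. 1)"
    by (subst genfun_reindex) (auto intro!: genfun_cong)
  also have "\<dots> = fps_X ^ Suc s * ?G k" by (rule genfun_add_weight)
  finally have G: "?G (Suc k) = fps_X ^ Suc s * ?G k" .
  have "{k..} = {k} \<union> {Suc k..}" by auto
  then have "?G k = genfun ({k} \<union> {Suc k..}) (\<lambda>v. Suc s * v) (\<lambda>_. 1)" by simp
  also have "\<dots> = genfun {k} (\<lambda>v. Suc s * v) (\<lambda>_. 1) + ?G (Suc k)"
    by (rule genfun_Un[OF fin fin]) auto
  also have "genfun {k} (\<lambda>v. Suc s * v) (\<lambda>_. 1) = (fps_X ^ (Suc s * k) :: 'a fps)"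
  proof (rule fps_ext)
    fix n
    have "{x. x \<in> {k} \<and> Suc s * x = n} = (if n = Suc s * k then {k} else {})" by auto
    then show "fps_nth (genfun {k} (\<lambda>v. Suc s * v) (\<lambda>_. 1)) n = fps_nth (fps_X ^ (Suc s * k) :: 'a fps) n"
      unfolding genfun_nth fps_X_power_nth by simp
  qed
  finally have "?G k - fps_X ^ Suc s * ?G k = fps_X ^ (Suc s * k)"
    unfolding G by (metis add_diff_cancel_right')
  then show ?thesis by (simp only: left_diff_distrib mult_1)
qed

abbreviation cgf :: "(nat \<times> colour) list set \<Rightarrow> 'a::comm_ring_1 fps" where
  "cgf S \<equiv> genfun S cweight (\<lambda>_. 1)"

lemma finite_cpred: "finite {xs \<in> cpred c s r t. cweight xs = n}"
  by (rule finite_subset[OF _ finite_lists_bounded[of s n]]) (auto simp: cpred_def)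

text \<open>The last value is contained in all \<open>Suc s\<close> parts, so summing over it gives
  a geometric series in \<open>fps_X ^ Suc s\<close>; its denominator is moved to the left.\<close>

lemma cgf_csnoc:
  "(1 - fps_X ^ Suc s) * cgf (csnoc c ` ({k..} \<times> cpred c s r t)) =
   (fps_X ^ (Suc s * k + is_b c) * cgf (cpred c s r t) :: 'a::comm_ring_1 fps)"
proof -
  have fin: "finite {x \<in> A. Suc s * x = n}" for A n
    by (rule finite_subset[of _ "{..n}"]) auto
  have "cgf (csnoc c ` ({k..} \<times> cpred c s r t)) =
      genfun ({k..} \<times> cpred c s r t) (\<lambda>x. (case x of (v, xs) \<Rightarrow> Suc s * v + cweight xs) + is_b c)
        (\<lambda>(v, xs). 1 * 1 :: 'a)"
    by (subst genfun_reindex[OF inj_csnoc], rule genfun_cong)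
      (auto simp: csnoc_def cweight_lift_snoc cpred_def)
  also have "\<dots> = fps_X ^ is_b c *
      (genfun {k..} (\<lambda>v. Suc s * v) (\<lambda>_. 1) * cgf (cpred c s r t))"
    by (subst genfun_add_weight, subst genfun_Times[OF fin finite_cpred]) simp
  finally have "(1 - fps_X ^ Suc s) * cgf (csnoc c ` ({k..} \<times> cpred c s r t)) =
      fps_X ^ is_b c * cgf (cpred c s r t) *
      ((1 - fps_X ^ Suc s) * genfun {k..} (\<lambda>v. Suc s * v) (\<lambda>_. 1 :: 'a))"
    by (simp only: mult_ac)
  then show ?thesis unfolding genfun_geometric by (simp add: power_add mult_ac)
qed

text \<open>The summands correspond to the colours of the last part. Its least admissible value is
  the gap to \<open>e\<close>, and the additional 1 in the second exponent is
  \<open>is_b ColB\<close>.\<close>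

lemma cgf_Suc:
  "(1 - fps_X ^ Suc s) * cgf (cparts e (Suc s) r t) =
     (fps_X ^ (Suc s * gap ColA e) * cgf (cpred ColA s r t) +
      fps_X ^ (Suc s * gap ColB e + 1) * cgf (cpred ColB s r t) +
      fps_X ^ (Suc s * gap ColU e) * cgf (cparts ColU s r t) :: 'a::comm_ring_1 fps)"
proof -
  let ?G = "cgf :: _ \<Rightarrow> 'a fps"
  let ?I = "\<lambda>c. csnoc c ` ({gap c e..} \<times> cpred c s r t)"
  have sub: "?I c \<subseteq> cparts e (Suc s) r t" for c
    unfolding cparts_Suc by (cases c) auto
  have fin: "finite {x \<in> ?I c. cweight x = n}" for c n
    by (rule finite_subset[OF _ finite_cparts[of e "Suc s" r t n]]) (use sub in blast)
  have disj: "?I c \<inter> ?I c' = {}" if "c \<noteq> c'" for c c'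
    using that by (auto simp: csnoc_def)
  have "?G (cparts e (Suc s) r t) = ?G (?I ColA \<union> (?I ColB \<union> ?I ColU))"
    unfolding cparts_Suc by simp
  also have "\<dots> = ?G (?I ColA) + ?G (?I ColB \<union> ?I ColU)"
    by (rule genfun_Un) (use fin[of ColA] fin[of ColB] fin[of ColU] in
        \<open>auto simp: disj Int_Un_distrib Collect_disj_eq conj_disj_distribR\<close>)
  also have "?G (?I ColB \<union> ?I ColU) = ?G (?I ColB) + ?G (?I ColU)"
    by (rule genfun_Un) (use fin disj in auto)
  finally have "(1 - fps_X ^ Suc s) * ?G (cparts e (Suc s) r t) =
     (1 - fps_X ^ Suc s) * ?G (?I ColA) + ((1 - fps_X ^ Suc s) * ?G (?I ColB)
       + (1 - fps_X ^ Suc s) * ?G (?I ColU))"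
    by (simp only: distrib_left)
  then show ?thesis
    unfolding cgf_csnoc by (simp add: is_b_def cpred_simps)
qed

section \<open>The closed product formula\<close>

definition qexp :: "nat \<Rightarrow> nat \<Rightarrow> nat" where
  "qexp r t = r\<^sup>2 + r + t\<^sup>2 + t - ((r + t + 1) choose 2)"

text \<open>Doubling removes the binomial coefficient. Non-negativity of the square shows that the
  truncated subtraction in \<open>qexp\<close> cuts nothing off.\<close>

lemma qexp_double: "2 * int (qexp r t) = (int r - int t)\<^sup>2 + int r + int t"
proof -
  have c: "2 * ((r + t + 1) choose 2) = (r + t + 1) * (r + t)"
    by (simp add: choose_two)
  have "(r + t + 1) * (r + t) \<le> 2 * (r\<^sup>2 + r + t\<^sup>2 + t)"
  proof -
    have "0 \<le> (int r - int t)\<^sup>2" by simp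
    then have "int ((r + t + 1) * (r + t)) \<le> int (2 * (r\<^sup>2 + r + t\<^sup>2 + t))"
      by (simp add: power2_eq_square algebra_simps)
    then show ?thesis by (simp only: of_nat_le_iff)
  qed
  then have "(r + t + 1) choose 2 \<le> r\<^sup>2 + r + t\<^sup>2 + t"
    unfolding c[symmetric] by (simp only: mult_le_cancel1)
  then have "2 * int (qexp r t) = 2 * int (r\<^sup>2 + r + t\<^sup>2 + t) - int (2 * ((r + t + 1) choose 2))"
    by (simp add: qexp_def of_nat_diff)
  then show ?thesis unfolding c by (simp add: power2_eq_square algebra_simps)
qed

lemma qexp_0 [simp]: "qexp 0 0 = 0"
  by (simp add: qexp_def)

text \<open>Written additively because the increment \<open>Suc r - t\<close> may be
  negative.\<close>

lemma qexp_Suc_left: "qexp (Suc r) t + t = qexp r t + Suc r"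
  using qexp_double[of "Suc r" t] qexp_double[of r t]
  by (simp add: power2_eq_square algebra_simps)

lemma qexp_Suc_right: "qexp r (Suc t) + r = qexp r t + Suc t"
  using qexp_double[of r "Suc t"] qexp_double[of r t]
  by (simp add: power2_eq_square algebra_simps)

lemma qexp_ge: "r + t \<le> 2 * qexp r t"
  using qexp_double[of r t] zero_le_power2[of "int r - int t"] by linarith

abbreviation qfac :: "nat \<Rightarrow> 'a::field fps" where
  "qfac n \<equiv> qpoch fps_X fps_X n"

abbreviation qfac2 :: "nat \<Rightarrow> 'a::field fps" where
  "qfac2 n \<equiv> qpoch (fps_X ^ 2) (fps_X ^ 2) n"

abbreviation mqfac :: "nat \<Rightarrow> 'a::field fps" where
  "mqfac n \<equiv> qpoch (- fps_X) fps_X n"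

definition cden :: "nat \<Rightarrow> nat \<Rightarrow> nat \<Rightarrow> 'a::field fps" where
  "cden s r t = qfac (s - (r + t)) * qfac2 r * qfac2 t"

lemma one_minus_X_power_nonzero: "1 - fps_X ^ Suc s \<noteq> (0 :: 'a::field fps)"
proof
  assume "1 - fps_X ^ Suc s = (0 :: 'a fps)"
  then have "fps_nth (1 - fps_X ^ Suc s :: 'a fps) 0 = 0" by (simp only: fps_zero_nth)
  then show False by (simp add: fps_X_power_nth)
qed

lemma ccount_le: "ccount ColA xs + ccount ColB xs \<le> length xs"
  by (induction xs) (auto simp: ccount_def)

lemma cparts_eq_empty: "s < r + t \<Longrightarrow> cparts e s r t = {}"
proof (rule equals0I)
  fix xs assume "s < r + t" "xs \<in> cparts e s r t"
  then show False using ccount_le[of xs] by (simp add: cparts_def)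
qed

lemma cparts_0: "cparts e 0 r t = (if r = 0 \<and> t = 0 then {[]} else {})"
  by (auto simp: cparts_def ccount_def)

lemma cgf_0: "cgf (cparts e 0 0 0) = 1"
proof -
  have "{x. x \<in> {[]} \<and> cweight x = n} = (if n = 0 then {[]} else {})" for n
    by (auto simp: cweight_def)
  then show ?thesis by (auto simp: cparts_0 fps_eq_iff genfun_nth)
qed

text \<open>In the formula for the end colour \<open>ColU\<close> a factor \<open>1 + q ^ N\<close> of \<open>(-q; q)\<^sub>N\<close> is cancelled. At
  \<open>N = 0\<close> the truncated subtraction in \<open>mqfac (N - 1)\<close> would give \<open>2\<close> instead of \<open>1\<close>.\<close>

lemma cgf_closed:
  fixes s r t :: nat
  defines "N \<equiv> r + t"
  assumes "N \<le> s"
  shows "(N = 0 \<longrightarrow> (\<forall>e. cgf (cparts e s r t) * cden s r t = (1 :: 'a::field fps))) \<and>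
    (N > 0 \<longrightarrow>
      cgf (cparts ColA s r t) * cden s r t = (fps_X ^ qexp r t * mqfac N :: 'a fps) \<and>
      cgf (cparts ColB s r t) * cden s r t * fps_X ^ r = (fps_X ^ (qexp r t + t) * mqfac N :: 'a fps) \<and>
      cgf (cparts ColU s r t) * cden s r t = (fps_X ^ qexp r t * mqfac (N - 1) * (fps_X ^ N + fps_X ^ (2 * t)) :: 'a fps))"
  using assms(2) unfolding N_def
proof (induction s arbitrary: r t)
  case 0
  then show ?case by (simp add: cgf_0 cden_def)
next
  case (Suc s)
  let ?X = "fps_X :: 'a fps"
  let ?G = "cgf :: _ \<Rightarrow> 'a fps"
  let ?D = "cden (Suc s) r t :: 'a fps"
  show ?case
  proof (cases "r + t = 0")
    case True
    then have [simp]: "r = 0" "t = 0" by auto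
    have IH: "?G (cparts ColU s 0 0) * qfac s = 1"
      using Suc.IH[of 0 0] by (simp add: cden_def)
    have "?G (cparts e (Suc s) 0 0) * qfac (Suc s) = 1" for e
    proof -
      have "(1 - ?X ^ Suc s) * ?G (cparts e (Suc s) 0 0) = ?G (cparts ColU s 0 0)"
        unfolding cgf_Suc by (simp add: cpred_simps gap_def)
      then have "?G (cparts e (Suc s) 0 0) * (qfac s * (1 - ?X ^ Suc s)) = ?G (cparts ColU s 0 0) * qfac s"
        by (simp add: mult_ac)
      then show ?thesis using IH by (simp add: qpoch_Suc)
    qed
    then show ?thesis by (simp add: cden_def)
  next
    case False
    \<comment> \<open>In terms of these powers the recursion becomes polynomial in \<open>R\<close>,
      \<open>T\<close> and \<open>Y\<close>, with the common factor \<open>E * m\<close>.\<close>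
    define m where "m = (mqfac (r + t - 1) :: 'a fps)"
    define R T Y E where "R = ?X ^ r" and "T = ?X ^ t" and "Y = ?X ^ (Suc s - (r + t))"
      and "E = ?X ^ qexp r t"
    have YRT: "?X ^ Suc s = Y * R * T"
      using Suc.prems unfolding Y_def R_def T_def by (simp flip: power_add)
    have M: "mqfac (r + t) = m * (1 + R * T)"
      using False by (cases "r + t") (simp_all add: m_def R_def T_def qpoch_Suc flip: power_add power_Suc)
    have X2: "?X ^ (2 * t) = T * T" "?X ^ (2 * r) = R * R"
      by (simp_all add: T_def R_def mult_2 power_add)
    \<comment> \<open>For \<open>r = 0\<close> both sides vanish, as \<open>R = 1\<close>. Otherwise
      the list without its last part has one a-coloured part less, and the denominators differ by
      the factor \<open>1 - R * R\<close>. The factor \<open>R\<close> on the left avoids a negative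
      exponent.\<close>
    have A: "?G (cpred ColA s r t) * ?D * R = E * T * m * (1 - R * R)"
    proof (cases r)
      case 0
      then show ?thesis by (simp add: cpred_simps R_def)
    next
      case (Suc r')
      have D: "?D = cden s r' t * (1 - R * R)"
        unfolding X2(2)[symmetric] by (simp add: Suc cden_def qpoch_Suc mult_ac flip: power_mult power_add power_Suc)
      have G: "?G (cparts ColA s r' t) * cden s r' t = ?X ^ qexp r' t * m"
        using Suc.IH[of r' t] Suc.prems Suc by (cases "r' + t = 0") (auto simp: m_def)
      have e: "?X ^ qexp r' t * R = E * T"
        using qexp_Suc_left[of r' t] unfolding E_def R_def T_def Suc by (simp flip: power_add)
      have "?G (cpred ColA s r t) * ?D * R = ?G (cparts ColA s r' t) * cden s r' t * (1 - R * R) * R"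
        unfolding D by (simp add: Suc cpred_simps mult.assoc)
      also have "\<dots> = (?X ^ qexp r' t * R) * m * (1 - R * R)"
        unfolding G by (simp only: mult_ac)
      finally show ?thesis unfolding e .
    qed
    have B: "?X * ?G (cpred ColB s r t) * ?D = E * m * (1 - T * T)"
    proof (cases t)
      case 0
      then show ?thesis by (simp add: cpred_simps T_def)
    next
      case (Suc t')
      have D: "?D = cden s r t' * (1 - T * T)"
        unfolding X2(1)[symmetric] by (simp add: Suc cden_def qpoch_Suc mult_ac flip: power_mult power_add power_Suc)
      have G: "?G (cparts ColB s r t') * cden s r t' * R = ?X ^ (qexp r t' + t') * m"
        using Suc.IH[of r t'] Suc.prems Suc by (cases "r + t' = 0") (auto simp: m_def R_def)
      have e: "?X * ?X ^ (qexp r t' + t') = E * R"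
        using qexp_Suc_right[of r t'] unfolding E_def R_def T_def Suc by (simp flip: power_add power_Suc)
      have "R * (?X * ?G (cpred ColB s r t) * ?D) = ?X * (?G (cparts ColB s r t') * cden s r t' * R) * (1 - T * T)"
        unfolding D by (simp add: Suc cpred_simps mult_ac)
      also have "\<dots> = (?X * ?X ^ (qexp r t' + t')) * m * (1 - T * T)"
        unfolding G by (simp only: mult_ac)
      also have "\<dots> = R * (E * m * (1 - T * T))" unfolding e by (simp only: mult_ac)
      finally show ?thesis by (simp add: R_def)
    qed
    have U: "?G (cparts ColU s r t) * ?D = E * m * (R * T + T * T) * (1 - Y)"
    \<comment> \<open>In this case the induction hypothesis does not apply, but there is no such
      list and \<open>1 - Y\<close> vanishes.\<close>
    proof (cases "r + t = Suc s")
      case True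
      then show ?thesis by (simp add: cparts_eq_empty Y_def)
    next
      case le: False
      have "Suc s - (r + t) = Suc (s - (r + t))" using le Suc.prems by simp
      then have "?D = cden s r t * (1 - Y)"
        by (simp add: cden_def Y_def qpoch_Suc mult_ac)
      moreover have "?G (cparts ColU s r t) * cden s r t = E * m * (R * T + T * T)"
        using Suc.IH[of r t] Suc.prems le False
        by (auto simp: m_def E_def R_def T_def mult_2 power_add)
      ultimately show ?thesis by (metis mult.assoc)
    qed
    have nz: "1 - Y * R * T \<noteq> 0"
      unfolding YRT[symmetric] by (rule one_minus_X_power_nonzero)
    have R0: "R \<noteq> 0" by (simp add: R_def)
    have rec: "(1 - Y * R * T) * (?G (cparts e (Suc s) r t) * ?D * R) =
        (Y * R * T) ^ gap ColA e * (E * T * m * (1 - R * R)) +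
        (Y * R * T) ^ gap ColB e * (E * m * (1 - T * T)) * R +
        (Y * R * T) ^ gap ColU e * (E * m * (R * T + T * T) * (1 - Y)) * R" for e
    proof -
      have "(1 - Y * R * T) * (?G (cparts e (Suc s) r t) * ?D * R) =
          ((1 - ?X ^ Suc s) * ?G (cparts e (Suc s) r t)) * (?D * R)"
        by (simp only: YRT mult_ac)
      also have "\<dots> = (?X ^ Suc s) ^ gap ColA e * (?G (cpred ColA s r t) * ?D * R) +
          (?X ^ Suc s) ^ gap ColB e * (?X * ?G (cpred ColB s r t) * ?D) * R +
          (?X ^ Suc s) ^ gap ColU e * (?G (cparts ColU s r t) * ?D) * R"
        unfolding cgf_Suc power_add power_mult power_one_right
        by (simp only: distrib_left distrib_right mult_ac)
      finally show ?thesis unfolding A B U YRT .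
    qed
    \<comment> \<open>Once the gaps are inserted, this and its two analogues below are polynomial
      identities; the factor \<open>1 - Y * R * T\<close>, which is
      \<open>1 - fps_X ^ Suc s\<close>, can then be cancelled.\<close>
    have "(1 - Y * R * T) * (?G (cparts ColA (Suc s) r t) * ?D * R) =
        (1 - Y * R * T) * (E * (m * (1 + R * T)) * R)"
      unfolding rec by (simp add: gap_def algebra_simps)
    then have 1: "?G (cparts ColA (Suc s) r t) * ?D = E * mqfac (r + t)"
      unfolding M using nz R0 by (simp only: mult_cancel_left mult_cancel_right) simp
    have "(1 - Y * R * T) * (?G (cparts ColB (Suc s) r t) * ?D * R) =
        (1 - Y * R * T) * (E * T * (m * (1 + R * T)))"
      unfolding rec by (simp add: gap_def algebra_simps)
    then have 2: "?G (cparts ColB (Suc s) r t) * ?D * R = E * T * mqfac (r + t)"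
      unfolding M using nz by (simp only: mult_cancel_left) simp
    have "(1 - Y * R * T) * (?G (cparts ColU (Suc s) r t) * ?D * R) =
        (1 - Y * R * T) * (E * m * (R * T + T * T) * R)"
      unfolding rec by (simp add: gap_def algebra_simps)
    then have 3: "?G (cparts ColU (Suc s) r t) * ?D = E * m * (R * T + T * T)"
      using nz R0 by (simp only: mult_cancel_left mult_cancel_right) simp
    show ?thesis
      using False 1 2 3 by (auto simp: E_def R_def T_def m_def power_add mult_2)
  qed
qed

lemma cgf_cparts:
  assumes "r + t \<le> s"
  shows "cgf (cparts ColA s r t) * cden s r t = (fps_X ^ qexp r t * mqfac (r + t) :: 'a::field fps)"
  using cgf_closed[OF assms, where ?'a = 'a] by (cases "r + t = 0") auto

section \<open>Overlining\<close>

definition nov :: "bool list \<Rightarrow> nat" where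
  "nov os = length (filter id os)"

lemma nov_simps [simp]: "nov [] = 0" "nov (o1 # os) = of_bool o1 + nov os"
  by (simp_all add: nov_def)

text \<open>\<open>mark xs os\<close> adds to each value the number of flags set from its position onwards, which
  accounts for the extra gap after an overlined part, and \<open>1\<close> if the colour is \<open>b\<close>. The latter
  removes the negative entries of the difference matrix: what is left of it is \<open>gap\<close>.\<close>

fun mark :: "(nat \<times> colour) list \<Rightarrow> bool list \<Rightarrow> part list" where
  "mark (x # xs) (o1 # os) = Part (fst x + is_b (snd x) + nov (o1 # os)) (snd x) o1 # mark xs os"
| "mark _ _ = []"

fun unmark :: "part list \<Rightarrow> (nat \<times> colour) list" where
  "unmark [] = []"
| "unmark (y # ys) = (pval y - is_b (pcol y) - nov (map overlined (y # ys)), pcol y) # unmark ys"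

text \<open>This is the sum of the one-based positions of the set flags, since a flag is counted
  once at every position up to its own.\<close>

fun oweight :: "bool list \<Rightarrow> nat" where
  "oweight [] = 0"
| "oweight (o1 # os) = nov (o1 # os) + oweight os"

text \<open>The colour correction is a difference of terms for the two parts and the overlining term
  depends on the left part only, so both are absorbed by the shift in \<open>mark\<close>.\<close>

lemma min_diff_eq:
  "min_diff x y = int (gap (pcol x) (pcol y)) + int (is_b (pcol x)) - int (is_b (pcol y)) + of_bool (overlined x)"
proof -
  obtain v c o1 v' c' o2 where "x = Part v c o1" "y = Part v' c' o2"
    by (cases x, cases y)
  then show ?thesis
    by (cases c; cases c'; cases o1; cases o2)
      (simp_all add: min_diff_def diff_matrix_def gap_def is_b_def numeral_eq_Suc)
qed

lemma length_mark [simp]: "length xs = length os \<Longrightarrow> length (mark xs os) = length xs"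
  by (induction xs os rule: list_induct2) auto

lemma length_unmark [simp]: "length (unmark ys) = length ys"
  by (induction ys) auto

lemma overlined_mark: "length xs = length os \<Longrightarrow> map overlined (mark xs os) = os"
  by (induction xs os rule: list_induct2) auto

lemma pcol_mark: "length xs = length os \<Longrightarrow> map pcol (mark xs os) = map snd xs"
  by (induction xs os rule: list_induct2) auto

lemma unmark_mark: "length xs = length os \<Longrightarrow> unmark (mark xs os) = xs"
  by (induction xs os rule: list_induct2) (auto simp: overlined_mark)

lemma mark_nth:
  "length xs = length os \<Longrightarrow> i < length xs \<Longrightarrow>
   mark xs os ! i = Part (fst (xs ! i) + is_b (snd (xs ! i)) + nov (drop i os)) (snd (xs ! i)) (os ! i)"
proof (induction xs os arbitrary: i rule: list_induct2)
  case (Cons x xs o1 os)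
  then show ?case by (cases i) auto
qed simp

lemma sum_pval_mark:
  "length xs = length os \<Longrightarrow> sum_list (map pval (mark xs os)) = cweight xs + oweight os"
  by (induction xs os rule: list_induct2) (auto simp: cweight_def)

lemma count_pcol_mark:
  assumes "length xs = length os"
  shows "length (filter (\<lambda>x. pcol x = c) (mark xs os)) = ccount c xs"
proof -
  have "length (filter (\<lambda>x. pcol x = c) (mark xs os)) = length (filter (\<lambda>k. k = c) (map pcol (mark xs os)))"
    by (simp add: filter_map o_def)
  then show ?thesis unfolding pcol_mark[OF assms] by (simp add: filter_map o_def ccount_def)
qed

lemma count_overlined_mark:
  assumes "length xs = length os"
  shows "length (filter (\<lambda>x. \<not> overlined x) (mark xs os)) = length (filter Not os)"
proof -
  have "length (filter (\<lambda>x. \<not> overlined x) (mark xs os)) = length (filter Not (map overlined (mark xs os)))"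
    by (simp add: filter_map o_def)
  then show ?thesis unfolding overlined_mark[OF assms] .
qed

section \<open>The bijection with jagged overpartitions\<close>

lemma cpart_nth_Suc:
  "cpart e xs \<Longrightarrow> Suc p < length xs \<Longrightarrow>
   fst (xs ! Suc p) + gap (snd (xs ! p)) (snd (xs ! Suc p)) \<le> fst (xs ! p)"
proof (induction xs arbitrary: p)
  case (Cons x xs)
  then show ?case by (cases p; cases xs) auto
qed simp

lemma cpart_nth_mono:
  assumes "cpart e xs" "p \<le> p'" "p' < length xs"
  shows "fst (xs ! p') \<le> fst (xs ! p)"
  using assms(2,3)
proof (induction p' rule: dec_induct)
  case (step p')
  then show ?case using cpart_nth_Suc[OF assms(1), of p'] by simp
qed simp

lemma cpart_last: "cpart e xs \<Longrightarrow> xs \<noteq> [] \<Longrightarrow> gap (snd (last xs)) e \<le> fst (last xs)"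
proof (induction xs)
  case (Cons x xs)
  then show ?case by (cases xs) auto
qed simp

lemma nov_drop_mono:
  assumes "p \<le> p'"
  shows "nov (drop p' os) \<le> nov (drop p os)"
proof -
  have "drop p os = take (p' - p) (drop p os) @ drop p' os"
    using assms by (metis append_take_drop_id drop_drop le_add_diff_inverse2)
  then have "filter id (drop p os) = filter id (take (p' - p) (drop p os)) @ filter id (drop p' os)"
    by (metis filter_append)
  then show ?thesis by (simp add: nov_def)
qed

lemma nov_drop_Suc: "p < length os \<Longrightarrow> nov (drop p os) = of_bool (os ! p) + nov (drop (Suc p) os)"
  by (metis Cons_nth_drop_Suc nov_simps(2))

lemma card_overlined_ge:
  "card {i. p \<le> i \<and> i < length os \<and> os ! i} = nov (drop p os)"
proof -
  have "{i. p \<le> i \<and> i < length os \<and> os ! i} = (\<lambda>i. i + p) ` {i. i < length (drop p os) \<and> id (drop p os ! i)}"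
  proof (intro equalityI subsetI)
    fix i assume "i \<in> {i. p \<le> i \<and> i < length os \<and> os ! i}"
    then show "i \<in> (\<lambda>i. i + p) ` {i. i < length (drop p os) \<and> id (drop p os ! i)}"
      by (intro image_eqI[of _ _ "i - p"]) auto
  qed (auto simp: add.commute)
  then show ?thesis
    by (simp add: card_image nov_def length_filter_conv_card)
qed

lemma last_mark:
  assumes "length xs = length os" "xs \<noteq> []"
  shows "last (mark xs os) =
    Part (fst (last xs) + is_b (snd (last xs)) + of_bool (last os)) (snd (last xs)) (last os)"
proof -
  have "os \<noteq> []" using assms by auto
  have "mark xs os \<noteq> []" using length_mark[OF assms(1)] assms(2) by (metis length_0_conv)
  then have "drop (length os - 1) os = [last os]"
    using \<open>os \<noteq> []\<close> by (metis append_butlast_last_id append_eq_conv_conj length_butlast)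
  then show ?thesis
    using assms \<open>os \<noteq> []\<close> \<open>mark xs os \<noteq> []\<close> mark_nth[OF assms(1), of "length os - 1"]
    by (simp add: last_conv_nth)
qed

lemma jagged_mark:
  assumes len: "length xs = length os" and xs: "cpart ColA xs"
  shows "jagged_overpartition (mark xs os)"
proof -
  have n: "mark xs os ! i = Part (fst (xs ! i) + is_b (snd (xs ! i)) + nov (drop i os)) (snd (xs ! i)) (os ! i)"
    if "i < length xs" for i
    using mark_nth[OF len that] .
  show ?thesis
    unfolding jagged_overpartition_def length_mark[OF len]
  proof (intro conjI allI impI)
    fix p assume p: "p < length xs" "overlined (mark xs os ! p)"
    \<comment> \<open>The flag at \<open>p\<close> makes \<open>nov\<close> drop strictly after
      \<open>p\<close>, while the underlying values never increase; a later part of the same colour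
      is therefore strictly smaller.\<close>
    then have s: "nov (drop p os) = Suc (nov (drop (Suc p) os))"
      using len by (simp add: n nov_drop_Suc)
    then show "0 < pval (mark xs os ! p)" using p by (simp add: n)
    fix p' assume p': "p < p' \<and> p' < length xs"
    show "\<not> (pval (mark xs os ! p') = pval (mark xs os ! p) \<and> pcol (mark xs os ! p') = pcol (mark xs os ! p))"
      using p p' s cpart_nth_mono[OF xs, of p p'] nov_drop_mono[of "Suc p" p' os] by (auto simp: n)
  next
    assume "mark xs os \<noteq> []"
    then have ne: "xs \<noteq> []" using len by auto
    show "last (mark xs os) \<notin> {Part 0 ColA False, Part 0 ColB False, Part 1 ColA True, Part 1 ColB True}"
      \<comment> \<open>The end colour \<open>ColA\<close> forces a last part of colour a to have
        underlying value at least 1; for colour b the same bound comes from \<open>is_b\<close>. A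
        set flag adds 1 in both cases.\<close>
      unfolding last_mark[OF len ne] using cpart_last[OF xs ne]
      by (cases "snd (last xs)") (auto simp: gap_def is_b_def)
  next
    fix p assume p: "Suc p < length xs"
    then show "min_diff (mark xs os ! p) (mark xs os ! Suc p) \<le>
        int (pval (mark xs os ! p)) - int (pval (mark xs os ! Suc p))"
      using cpart_nth_Suc[OF xs p] nov_drop_Suc[of p os] len
      by (simp add: min_diff_eq n)
  qed
qed

lemma jagged_ConsD:
  assumes "jagged_overpartition (y # ys)"
  shows "jagged_overpartition ys"
  unfolding jagged_overpartition_def
proof (intro conjI allI impI)
  note J = assms[unfolded jagged_overpartition_def]
  fix p assume p: "p < length ys" "overlined (ys ! p)"
  then show "0 < pval (ys ! p)" using J by (metis Suc_less_eq length_Cons nth_Cons_Suc)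
  fix p' assume "p < p' \<and> p' < length ys"
  then show "\<not> (pval (ys ! p') = pval (ys ! p) \<and> pcol (ys ! p') = pcol (ys ! p))"
    using J p by (metis Suc_less_eq length_Cons nth_Cons_Suc)
next
  assume "ys \<noteq> []"
  then show "last ys \<notin> {Part 0 ColA False, Part 0 ColB False, Part 1 ColA True, Part 1 ColB True}"
    using assms unfolding jagged_overpartition_def by simp
next
  fix p assume "Suc p < length ys"
  then show "min_diff (ys ! p) (ys ! Suc p) \<le> int (pval (ys ! p)) - int (pval (ys ! Suc p))"
    using assms unfolding jagged_overpartition_def by (metis Suc_less_eq length_Cons nth_Cons_Suc)
qed

text \<open>Surjectivity of \<open>mark\<close>, by induction from the last part to the
  first.\<close>

lemma jagged_unmark:
  "jagged_overpartition ys \<Longrightarrow> cpart ColA (unmark ys) \<and> mark (unmark ys) (map overlined ys) = ys"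
proof (induction ys)
  case (Cons y ys)
  have IH: "cpart ColA (unmark ys)" "mark (unmark ys) (map overlined ys) = ys"
    using Cons.IH jagged_ConsD[OF Cons.prems] by auto
  let ?k = "nov (map overlined (y # ys))"
  let ?f = "first ColA (unmark ys)"
  obtain v c o1 where y: "y = Part v c o1" by (cases y)
  \<comment> \<open>This bound gives the gap condition and also shows that the truncated
    subtractions in \<open>unmark\<close> are exact.\<close>
  have ge: "fst ?f + gap c (snd ?f) + is_b c + ?k \<le> v"
  proof (cases ys)
    case Nil
    have "y \<notin> {Part 0 ColA False, Part 0 ColB False, Part 1 ColA True, Part 1 ColB True}"
      "overlined y \<longrightarrow> 0 < pval y"
      using Cons.prems unfolding jagged_overpartition_def Nil by auto
    then show ?thesis using Nil y
      by (cases c; cases o1) (auto simp: gap_def is_b_def)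
  next
    case (Cons y' ys')
    have "Part (fst ?f + is_b (snd ?f) + nov (map overlined ys)) (snd ?f) (overlined y') = y'"
      using IH(2) unfolding Cons by simp
    then have y': "pval y' = fst ?f + is_b (snd ?f) + nov (map overlined ys)" "pcol y' = snd ?f"
      by (metis part.sel)+
    have "min_diff y y' \<le> int (pval y) - int (pval y')"
      using Cons.prems unfolding jagged_overpartition_def Cons
      by (metis Suc_less_eq length_Cons nth_Cons_0 nth_Cons_Suc zero_less_Suc)
    then show ?thesis unfolding min_diff_eq y' by (cases o1) (simp_all add: y)
  qed
  then show ?case using IH by (auto simp: y)
qed simp

text \<open>To a u-coloured part \<open>mark\<close> adds exactly the number of overlined parts from
  it onwards, so the equality in \<open>u_condition\<close> says that the underlying value is
  0.\<close>

lemma u_condition_mark: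
  assumes len: "length xs = length os" and xs: "cpart ColA xs"
  shows "u_condition (mark xs os) \<longleftrightarrow> ((0, ColU) \<in> set xs \<longrightarrow> last os)"
proof (cases "xs = []")
  case True
  then show ?thesis by (simp add: u_condition_def smallest_u_at_def)
next
  case False
  have n: "mark xs os ! i = Part (fst (xs ! i) + is_b (snd (xs ! i)) + nov (drop i os)) (snd (xs ! i)) (os ! i)"
    if "i < length xs" for i
    using mark_nth[OF len that] .
  have lst: "overlined (last (mark xs os)) = last os"
    by (simp add: last_mark[OF len False])
  have crd: "card {p'. p \<le> p' \<and> p' < length (mark xs os) \<and> overlined (mark xs os ! p')} = nov (drop p os)" for p
  proof -
    have "{p'. p \<le> p' \<and> p' < length (mark xs os) \<and> overlined (mark xs os ! p')} =
        {i. p \<le> i \<and> i < length os \<and> os ! i}"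
      using len by (auto simp: n)
    then show ?thesis by (simp only: card_overlined_ge)
  qed
  have "(\<exists>p. smallest_u_at (mark xs os) p \<and> pval (mark xs os ! p) = nov (drop p os)) \<longleftrightarrow> (0, ColU) \<in> set xs"
  proof
    assume "\<exists>p. smallest_u_at (mark xs os) p \<and> pval (mark xs os ! p) = nov (drop p os)"
    then obtain p where "p < length xs" "snd (xs ! p) = ColU" "fst (xs ! p) = 0"
      using len by (auto simp: smallest_u_at_def n)
    then show "(0, ColU) \<in> set xs" by (metis nth_mem prod.collapse)
  next
    assume "(0, ColU) \<in> set xs"
    then obtain i where i: "i < length xs" "xs ! i = (0, ColU)" by (metis in_set_conv_nth)
    define U where "U = {i. i < length xs \<and> snd (xs ! i) = ColU}"
    \<comment> \<open>The last u-coloured part minimises both the underlying value and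
      \<open>nov\<close>, and its underlying value is 0 because it does not precede position
      \<open>i\<close>.\<close>
    define p where "p = Max U"
    have "finite U" "i \<in> U" using i by (auto simp: U_def)
    then have p: "p \<in> U" "i \<le> p" and max: "\<And>j. j \<in> U \<Longrightarrow> j \<le> p"
      unfolding p_def by (metis Max_in empty_iff, metis Max_ge, metis Max_ge)
    then have "p < length xs" "snd (xs ! p) = ColU" by (auto simp: U_def)
    moreover have "fst (xs ! p) = 0"
      using cpart_nth_mono[OF xs p(2)] \<open>p < length xs\<close> i by simp
    moreover have "nov (drop p os) \<le> nov (drop j os)" if "j < length xs" "snd (xs ! j) = ColU" for j
      using that max by (intro nov_drop_mono) (auto simp: U_def)
    ultimately have "smallest_u_at (mark xs os) p \<and> pval (mark xs os ! p) = nov (drop p os)"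
      using len by (fastforce simp: smallest_u_at_def n is_b_def)
    then show "\<exists>p. smallest_u_at (mark xs os) p \<and> pval (mark xs os ! p) = nov (drop p os)" by blast
  qed
  then show ?thesis unfolding u_condition_def lst crd by blast
qed

text \<open>A part \<open>0\<close> of colour \<open>u\<close> can be inserted in exactly one way (up to repetition), namely before
  all other parts \<open>0\<close>. Hence the lists that violate \<open>u_condition\<close> with a final flag unset correspond to
  all lists with one part less.\<close>

fun insert_zero :: "(nat \<times> colour) list \<Rightarrow> (nat \<times> colour) list" where
  "insert_zero [] = [(0, ColU)]"
| "insert_zero (x # xs) = (if fst x = 0 then (0, ColU) # x # xs else x # insert_zero xs)"

lemma gap_le_1: "gap c c' \<le> 1" and gap_ColU [simp]: "gap ColU c = 0"
  by (simp_all add: gap_def)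

lemma remove1_insert_zero: "remove1 (0, ColU) (insert_zero xs) = xs"
  by (induction xs) auto

lemma zero_in_insert_zero: "(0, ColU) \<in> set (insert_zero xs)"
  by (induction xs) auto

lemma cweight_insert_zero: "cweight (insert_zero xs) = cweight xs"
  by (induction xs) (auto simp: cweight_def is_b_def)

lemma ccount_insert_zero: "c \<noteq> ColU \<Longrightarrow> ccount c (insert_zero xs) = ccount c xs"
  by (induction xs) (auto simp: ccount_def)

lemma length_insert_zero: "length (insert_zero xs) = Suc (length xs)"
  by (induction xs) auto

lemma cpart_insert_zero: "cpart ColA xs \<Longrightarrow> cpart ColA (insert_zero xs)"
proof (induction xs)
  case (Cons x xs)
  show ?case
  proof (cases "fst x = 0")
    case False
    have "fst (first ColA (insert_zero xs)) + gap (snd x) (snd (first ColA (insert_zero xs))) \<le> fst x"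
    \<comment> \<open>Unless the old successor of \<open>x\<close> stays in place, the new zero part
      follows \<open>x\<close> directly, and the positive value of \<open>x\<close> covers any
      gap.\<close>
    proof (cases "\<exists>y ys. xs = y # ys \<and> fst y \<noteq> 0")
      case True
      then show ?thesis using Cons.prems by auto
    next
      case c: False
      then have "first ColA (insert_zero xs) = (0, ColU)" by (cases xs) auto
      then show ?thesis using False gap_le_1[of "snd x" ColU] by simp
    qed
    then show ?thesis using False Cons by simp
  qed (use Cons.prems in simp)
qed simp

text \<open>Between parts of value 0 all gaps must vanish, but the gap from \<open>ColA\<close> or
  \<open>ColB\<close> to \<open>ColU\<close> is 1. Hence the zero parts of colour u precede all
  other zero parts.\<close>

lemma no_zero_u:
  "cpart ColA xs \<Longrightarrow> fst (first ColA xs) = 0 \<Longrightarrow> snd (first ColA xs) \<noteq> ColU \<Longrightarrow> (0, ColU) \<notin> set xs"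
proof (induction xs)
  case (Cons x xs)
  then have "fst (first ColA xs) = 0" "gap (snd x) (snd (first ColA xs)) = 0" by auto
  with Cons have "(0, ColU) \<notin> set xs" by (cases "snd x"; cases "snd (first ColA xs)") (auto simp: gap_def)
  with Cons.prems show ?case by auto
qed simp

lemma cpart_remove_zero:
  "cpart ColA xs \<Longrightarrow> (0, ColU) \<in> set xs \<Longrightarrow>
   cpart ColA (remove1 (0, ColU) xs) \<and> insert_zero (remove1 (0, ColU) xs) = xs"
proof (induction xs)
  case (Cons x xs)
  show ?case
  proof (cases "x = (0, ColU)")
    case True
    then have "fst (first ColA xs) = 0" using Cons.prems by auto
    then show ?thesis using True Cons.prems by (cases xs) auto
  next
    case False
    then have in_xs: "(0, ColU) \<in> set xs" using Cons.prems by auto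
    \<comment> \<open>This makes \<open>insert_zero\<close> pass over \<open>x\<close> and covers
      the gap when the part after \<open>x\<close> is the one removed.\<close>
    have x0: "fst x \<noteq> 0"
    proof
      assume "fst x = 0"
      with False have "snd x \<noteq> ColU" by (cases x) auto
      with \<open>fst x = 0\<close> no_zero_u[OF Cons.prems(1)] Cons.prems(2) show False by auto
    qed
    have "fst (first ColA (remove1 (0, ColU) xs)) + gap (snd x) (snd (first ColA (remove1 (0, ColU) xs))) \<le> fst x"
    proof (cases "\<exists>ys. xs = (0, ColU) # ys")
      case True
      then obtain ys where ys: "xs = (0, ColU) # ys" by blast
      then have "fst (first ColA ys) = 0" using Cons.prems by auto
      then show ?thesis using x0 ys gap_le_1[of "snd x" "snd (first ColA ys)"] by simp
    next
      case c: False
      then have "first ColA (remove1 (0, ColU) xs) = first ColA xs" using in_xs by (cases xs) auto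
      then show ?thesis using Cons.prems by simp
    qed
    then show ?thesis using False x0 Cons in_xs by auto
  qed
qed simp

lemma cparts_insert_zero:
  "insert_zero ` cparts ColA s r t = {xs \<in> cparts ColA (Suc s) r t. (0, ColU) \<in> set xs}"
proof (intro equalityI subsetI)
  fix xs assume xs: "xs \<in> {xs \<in> cparts ColA (Suc s) r t. (0, ColU) \<in> set xs}"
  define ys where "ys = remove1 (0, ColU) xs"
  have "cpart ColA ys" "xs = insert_zero ys"
    using xs cpart_remove_zero[of xs] by (auto simp: cparts_def ys_def)
  then show "xs \<in> insert_zero ` cparts ColA s r t"
    using xs by (auto simp: cparts_def length_insert_zero ccount_insert_zero)
qed (auto simp: cparts_def length_insert_zero ccount_insert_zero zero_in_insert_zero cpart_insert_zero)

lemma cgf_zero_u: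
  "cgf {xs \<in> cparts ColA (Suc s) r t. (0, ColU) \<in> set xs} = cgf (cparts ColA s r t)"
proof -
  have "inj_on insert_zero (cparts ColA s r t)"
    by (rule inj_on_inverseI[of _ "remove1 (0, ColU)"]) (rule remove1_insert_zero)
  then show ?thesis unfolding cparts_insert_zero[symmetric]
    by (subst genfun_reindex) (auto intro!: genfun_cong simp: cweight_insert_zero)
qed

section \<open>Generating function of the flags\<close>

definition wprod :: "'a::field \<Rightarrow> nat \<Rightarrow> 'a fps" where
  "wprod d s = (\<Prod>p<s. fps_const d + fps_X ^ Suc p)"

lemma wprod_simps [simp]: "wprod d 0 = 1" "wprod d (Suc s) = wprod d s * (fps_const d + fps_X ^ Suc s)"
  by (simp_all add: wprod_def)

lemma nov_snoc: "nov (os @ [o1]) = nov os + of_bool o1"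
  by (induction os) auto

lemma oweight_snoc: "oweight (os @ [o1]) = oweight os + of_bool o1 * Suc (length os)"
  by (induction os) (auto simp: nov_snoc)

definition ogf :: "'a::field \<Rightarrow> bool list set \<Rightarrow> 'a fps" where
  "ogf d S = genfun S oweight (\<lambda>os. d ^ length (filter Not os))"

definition flags :: "nat \<Rightarrow> bool list set" where
  "flags s = {os. length os = s}"

lemma finite_flags: "finite (flags s)"
  using finite_lists_length_eq[of "UNIV :: bool set" s] by (simp add: flags_def)

lemma ogf_snoc_True: "ogf d ((\<lambda>os. os @ [True]) ` flags s) = fps_X ^ Suc s * ogf d (flags s)"
proof -
  have "ogf d ((\<lambda>os. os @ [True]) ` flags s) =
      genfun (flags s) (\<lambda>os. oweight os + Suc s) (\<lambda>os. d ^ length (filter Not os))"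
    unfolding ogf_def by (subst genfun_reindex) (auto intro!: genfun_cong injI inj_onI simp: oweight_snoc flags_def)
  then show ?thesis by (simp only: genfun_add_weight ogf_def)
qed

lemma ogf_snoc_False: "ogf d ((\<lambda>os. os @ [False]) ` flags s) = fps_const d * ogf d (flags s)"
proof -
  have "ogf d ((\<lambda>os. os @ [False]) ` flags s) =
      genfun (flags s) oweight (\<lambda>os. d * d ^ length (filter Not os))"
    unfolding ogf_def by (subst genfun_reindex) (auto intro!: genfun_cong injI inj_onI simp: oweight_snoc flags_def)
  then show ?thesis by (simp only: genfun_mult_const ogf_def)
qed

lemma flags_Suc: "flags (Suc s) = (\<lambda>os. os @ [True]) ` flags s \<union> (\<lambda>os. os @ [False]) ` flags s"
proof (intro equalityI subsetI)
  fix os assume "os \<in> flags (Suc s)"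
  then obtain os' o1 where "os = os' @ [o1]" "length os' = s"
    by (auto simp: flags_def length_Suc_conv_rev)
  then show "os \<in> (\<lambda>os. os @ [True]) ` flags s \<union> (\<lambda>os. os @ [False]) ` flags s"
    by (cases o1) (auto simp: flags_def)
qed (auto simp: flags_def)

lemma ogf_flags: "ogf d (flags s) = wprod d s"
proof (induction s)
  case 0
  have "{os. os \<in> flags 0 \<and> oweight os = n} = (if n = 0 then {[]} else {})" for n
    by (auto simp: flags_def)
  then show ?case by (auto simp: ogf_def fps_eq_iff genfun_nth)
next
  case (Suc s)
  have "ogf d (flags (Suc s)) = ogf d ((\<lambda>os. os @ [True]) ` flags s) + ogf d ((\<lambda>os. os @ [False]) ` flags s)"
    unfolding flags_Suc ogf_def by (rule genfun_Un) (auto simp: finite_flags)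
  then show ?case unfolding ogf_snoc_True ogf_snoc_False Suc.IH by (simp add: algebra_simps)
qed

lemma flags_last: "{os \<in> flags (Suc s). \<not> last os} = (\<lambda>os. os @ [False]) ` flags s"
  unfolding flags_Suc by auto

section \<open>Overpartitions with a fixed number of parts\<close>

definition pweight :: "part list \<Rightarrow> nat" where
  "pweight ys = sum_list (map pval ys)"

definition good :: "nat \<Rightarrow> nat \<Rightarrow> part list set" where
  "good r t = {ys. jagged_overpartition ys \<and> u_condition ys \<and>
     length (filter (\<lambda>x. pcol x = ColA) ys) = r \<and> length (filter (\<lambda>x. pcol x = ColB) ys) = t}"

definition pgf :: "'a::field \<Rightarrow> part list set \<Rightarrow> 'a fps" where
  "pgf d S = genfun S pweight (\<lambda>ys. d ^ length (filter (\<lambda>x. \<not> overlined x) ys))"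

lemma finite_part_lists: "finite {ys. length ys = s \<and> pweight ys = n}"
proof (rule finite_subset)
  let ?P = "(\<lambda>(v, c, b). Part v c b) ` ({..n} \<times> {ColA, ColB, ColU} \<times> UNIV)"
  have P: "y \<in> ?P" if "pval y \<le> n" for y
  proof (cases y)
    case (Part v c b)
    then show ?thesis using that by (cases c) (auto simp: image_iff)
  qed
  show "{ys. length ys = s \<and> pweight ys = n} \<subseteq> {ys. set ys \<subseteq> ?P \<and> length ys = s}"
  proof (intro subsetI CollectI conjI)
    fix ys y assume ys: "ys \<in> {ys. length ys = s \<and> pweight ys = n}" and "y \<in> set ys"
    then have "pval y \<in> set (map pval ys)" by simp
    then have "pval y \<le> pweight ys" unfolding pweight_def by (rule member_le_sum_list) simp
    then show "y \<in> ?P" using P ys by blast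
  qed auto
  show "finite {ys. set ys \<subseteq> ?P \<and> length ys = s}"
    by (rule finite_lists_length_eq) auto
qed

lemma inj_mark: "inj_on (\<lambda>(xs, os). mark xs os) (cparts e s r t \<times> flags s)"
  by (rule inj_on_inverseI[of _ "\<lambda>ys. (unmark ys, map overlined ys)"])
    (auto simp: cparts_def flags_def unmark_mark overlined_mark)

lemma pgf_mark:
  assumes "S \<subseteq> cparts ColA s r t" "T \<subseteq> flags s"
  shows "pgf d ((\<lambda>(xs, os). mark xs os) ` (S \<times> T)) = cgf S * ogf d T"
proof -
  have len: "length xs = length os" if "xs \<in> S" "os \<in> T" for xs os
    using that assms by (auto simp: cparts_def flags_def)
  have "inj_on (\<lambda>(xs, os). mark xs os) (S \<times> T)"
    by (rule inj_on_subset[OF inj_mark[of ColA s r t]]) (use assms in auto)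
  then have "pgf d ((\<lambda>(xs, os). mark xs os) ` (S \<times> T)) =
      genfun (S \<times> T) (\<lambda>(xs, os). cweight xs + oweight os) (\<lambda>(xs, os). 1 * d ^ length (filter Not os))"
    unfolding pgf_def
    by (subst genfun_reindex)
      (auto intro!: genfun_cong simp: pweight_def sum_pval_mark len count_overlined_mark)
  also have "\<dots> = cgf S * ogf d T"
    unfolding ogf_def
  proof (rule genfun_Times)
    show "finite {x \<in> S. cweight x = n}" for n
      by (rule finite_subset[OF _ finite_cparts[of ColA s r t n]]) (use assms in auto)
    show "finite {x \<in> T. oweight x = n}" for n
      by (rule finite_subset[OF _ finite_flags[of s]]) (use assms in auto)
  qed
  finally show ?thesis .
qed

text \<open>The pairs violating the condition have a part 0_u and an unset last flag. These are
  independent requirements on the two components, so the violating pairs are counted by a product,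
  which is subtracted.\<close>

lemma pgf_good:
  "pgf d {ys \<in> good r t. length ys = s} = cgf (cparts ColA s r t) * wprod d s -
     (case s of 0 \<Rightarrow> 0 | Suc s' \<Rightarrow> cgf (cparts ColA s' r t) * (fps_const d * wprod d s'))"
proof -
  let ?m = "\<lambda>(xs, os). mark xs os"
  let ?Z = "{xs \<in> cparts ColA s r t. (0, ColU) \<in> set xs}" and ?F = "{os \<in> flags s. \<not> last os}"
  have len: "length xs = length os" if "xs \<in> cparts ColA s r t" "os \<in> flags s" for xs os
    using that by (auto simp: cparts_def flags_def)
  let ?good = "{ys \<in> good r t. length ys = s}"
  have surj: "ys \<in> ?m ` (cparts ColA s r t \<times> flags s)" if "ys \<in> ?good" for ys
  proof -
    define xs os where "xs = unmark ys" and "os = map overlined ys"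
    have *: "cpart ColA xs" "ys = mark xs os"
      using that jagged_unmark[of ys] by (auto simp: good_def xs_def os_def)
    have l: "length xs = length os" by (simp add: xs_def os_def)
    then have "xs \<in> cparts ColA s r t" "os \<in> flags s"
      using that * by (auto simp: good_def cparts_def flags_def count_pcol_mark)
    then show ?thesis using *(2) by auto
  qed
  have good_mark: "mark xs os \<in> ?good \<longleftrightarrow> ((0, ColU) \<in> set xs \<longrightarrow> last os)"
    if "xs \<in> cparts ColA s r t" "os \<in> flags s" for xs os
    using that len[OF that] jagged_mark u_condition_mark
    by (auto simp: good_def cparts_def count_pcol_mark)
  have eq: "?m ` (cparts ColA s r t \<times> flags s) = ?good \<union> ?m ` (?Z \<times> ?F)"
    using surj good_mark by fast
  have disj: "?good \<inter> ?m ` (?Z \<times> ?F) = {}"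
    using good_mark by auto
  have fin: "finite {ys \<in> ?good. pweight ys = n}" "finite {ys \<in> ?m ` (?Z \<times> ?F). pweight ys = n}" for n
    by (rule finite_subset[OF _ finite_part_lists[of s n]], auto simp: cparts_def flags_def)+
  have "cgf (cparts ColA s r t) * wprod d s = pgf d (?m ` (cparts ColA s r t \<times> flags s))"
    by (subst pgf_mark[OF order_refl order_refl]) (simp add: ogf_flags)
  also have "\<dots> = pgf d ?good + pgf d (?m ` (?Z \<times> ?F))"
    unfolding eq pgf_def by (rule genfun_Un[OF fin disj])
  also have "pgf d (?m ` (?Z \<times> ?F)) = cgf ?Z * ogf d ?F"
    by (rule pgf_mark) auto
  also have "\<dots> = (case s of 0 \<Rightarrow> 0 | Suc s' \<Rightarrow> cgf (cparts ColA s' r t) * (fps_const d * wprod d s'))"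
  proof (cases s)
    case 0
    \<comment> \<open>Here \<open>?F\<close> involves the unspecified value \<open>last []\<close>;
      the empty factor \<open>?Z\<close> makes it irrelevant.\<close>
    then have Z: "?Z = {}" by (auto simp: cparts_def)
    show ?thesis unfolding Z using 0 by simp
  next
    case (Suc s')
    show ?thesis unfolding Suc cgf_zero_u flags_last ogf_snoc_False by (simp add: ogf_flags)
  qed
  finally show ?thesis by (simp add: algebra_simps)
qed

text \<open>Without 0_u only 0_a has weight 0, and it must be followed by a part of colour b, whose
  weight is positive. The term \<open>is_b\<close> reserves the surplus of a b-coloured head for a
  part 0_a in front of it.\<close>

lemma length_le_cweight:
  "cpart ColA xs \<Longrightarrow> (0, ColU) \<notin> set xs \<Longrightarrow>
   length xs + is_b (snd (first ColA xs)) \<le> 2 * cweight xs"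
proof (induction xs)
  case (Cons x xs)
  then have IH: "length xs + is_b (snd (first ColA xs)) \<le> 2 * cweight xs" by simp
  have cw: "cweight (x # xs) = fst x + is_b (snd x) + cweight xs" by (simp add: cweight_def)
  show ?case
  proof (cases "fst x + is_b (snd x) = 0")
    case True
    then have "snd x = ColA" using Cons.prems by (cases x; cases "snd x") (auto simp: is_b_def)
    with True Cons.prems have "snd (first ColA xs) = ColB"
      by (cases "snd (first ColA xs)") (auto simp: gap_def)
    then show ?thesis using IH True cw by (simp add: is_b_def)
  next
    case False
    then show ?thesis using IH cw by (cases "snd x") (auto simp: is_b_def)
  qed
qed (simp add: is_b_def)

text \<open>The set last flag alone contributes 1 to \<open>nov\<close> at every position.\<close>

lemma length_le_oweight: "os \<noteq> [] \<Longrightarrow> last os \<Longrightarrow> length os \<le> oweight os"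
proof (induction os)
  case (Cons o1 os)
  show ?case
  proof (cases os)
    case c: (Cons o2 os')
    then have "nov os > 0"
      using Cons.prems unfolding nov_def by (metis filter_empty_conv id_apply last_ConsR last_in_set length_greater_0_conv list.distinct(1))
    moreover have "length os \<le> oweight os" using Cons c by simp
    ultimately show ?thesis by simp
  qed (use Cons.prems in simp)
qed simp

text \<open>Without a part 0_u the coloured partition bounds the length, otherwise the set last flag
  does. Thus only finitely many lengths occur for a given sum.\<close>

lemma length_good: "ys \<in> good r t \<Longrightarrow> length ys \<le> 2 * pweight ys"
proof -
  assume ys: "ys \<in> good r t"
  define xs os where "xs = unmark ys" and "os = map overlined ys"
  have l: "length xs = length os" "length xs = length ys" by (simp_all add: xs_def os_def)
  have *: "cpart ColA xs" "ys = mark xs os"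
    using ys jagged_unmark[of ys] by (auto simp: good_def xs_def os_def)
  then have "(0, ColU) \<in> set xs \<longrightarrow> last os"
    using ys u_condition_mark[OF l(1)] by (auto simp: good_def)
  then have "length xs \<le> 2 * (cweight xs + oweight os)"
    using length_le_cweight[OF *(1)] length_le_oweight[of os] l(1) by (cases "os = []") auto
  then show ?thesis using l(2) sum_pval_mark[OF l(1)] *(2) by (simp add: pweight_def)
qed

section \<open>Summation\<close>

text \<open>The factor independent of \<open>m\<close> in the generating function of coloured
  partitions with \<open>r + t + m\<close> parts.\<close>

definition cnum :: "nat \<Rightarrow> nat \<Rightarrow> 'a::field fps" where
  "cnum r t = fps_X ^ qexp r t * mqfac (r + t) * inverse (qfac2 r * qfac2 t)"

lemma mult_inverse_eq_1: "fps_nth f 0 \<noteq> 0 \<Longrightarrow> f * inverse f = (1 :: 'a::field fps)"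
  by (simp add: inverse_mult_eq_1' mult.commute)

lemma qfac_nth_0: "fps_nth (qfac n :: 'a::field fps) 0 = 1"
  and qfac2_nth_0: "fps_nth (qfac2 n :: 'a::field fps) 0 = 1"
  by (rule qpoch_nth_0, simp)+

lemma cgf_shift:
  "cgf (cparts ColA (r + t + m) r t) = (cnum r t * inverse (qfac m) :: 'a::field fps)"
proof -
  let ?D = "qfac2 r * qfac2 t :: 'a fps"
  have D: "?D * inverse ?D = 1"
    by (rule mult_inverse_eq_1) (simp add: qfac2_nth_0)
  have Q: "qfac m * inverse (qfac m) = (1 :: 'a fps)"
    by (rule mult_inverse_eq_1) (simp add: qfac_nth_0)
  have "cgf (cparts ColA (r + t + m) r t) =
      cgf (cparts ColA (r + t + m) r t) * (qfac m * inverse (qfac m)) * (?D * inverse ?D)"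
    unfolding D Q by simp
  also have "\<dots> = (cgf (cparts ColA (r + t + m) r t) * (qfac m * qfac2 r * qfac2 t)) *
      inverse (qfac m) * inverse ?D"
    by (simp only: mult_ac)
  also have "cgf (cparts ColA (r + t + m) r t) * (qfac m * qfac2 r * qfac2 t) =
      (fps_X ^ qexp r t * mqfac (r + t) :: 'a fps)"
    using cgf_cparts[of r t "r + t + m", where ?'a = 'a] by (simp add: cden_def)
  finally show ?thesis by (simp only: cnum_def mult_ac)
qed

lemma wprod_add: "wprod d (n + m) = wprod d n * (\<Prod>p<m. fps_const d + fps_X ^ (n + Suc p))"
  by (induction m) (simp_all add: mult.assoc)

text \<open>The correction for parts 0_u turns the contribution of each length into one summand of
  the \<open>q\<close>-binomial series.\<close>

lemma pgf_good_shift: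
  "pgf d {ys \<in> good r t. length ys = r + t + m} =
   cnum r t * wprod d (r + t) * (fps_X ^ m * qbin_term d (r + t) m)"
proof (cases m)
  case 0
  have "pgf d {ys \<in> good r t. length ys = r + t} = cgf (cparts ColA (r + t) r t) * wprod d (r + t)"
    unfolding pgf_good using cparts_eq_empty[of "r + t - 1" r t ColA]
    by (cases "r + t") auto
  then show ?thesis using 0 cgf_shift[of r t 0, where ?'a = 'a] by (simp add: qbin_term_def)
next
  case (Suc k)
  let ?N = "r + t" and ?d = "fps_const d"
  have q: "inverse (qfac k) = (1 - fps_X ^ Suc k) * inverse (qfac (Suc k) :: 'a fps)"
  proof -
    have "inverse (qfac k) = inverse (qfac k) * (qfac (Suc k) * inverse (qfac (Suc k) :: 'a fps))"
      using mult_inverse_eq_1[of "qfac (Suc k) :: 'a fps"] by (simp add: qfac_nth_0)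
    also have "\<dots> = inverse (qfac k) * (qfac k * (1 - fps_X ^ Suc k) * inverse (qfac (Suc k)))"
      by (simp only: qpoch_Suc power_Suc mult.assoc)
    also have "\<dots> = (qfac k * inverse (qfac k)) * ((1 - fps_X ^ Suc k) * inverse (qfac (Suc k)))"
      by (simp only: mult_ac)
    also have "qfac k * inverse (qfac k) = (1 :: 'a fps)"
      by (rule mult_inverse_eq_1) (simp add: qfac_nth_0)
    finally show ?thesis by simp
  qed
  \<comment> \<open>The extra factor is the one for \<open>p = 0\<close> after the index of the
    product is shifted by one.\<close>
  have w: "wprod d (?N + k) * (?d + fps_X ^ ?N) = wprod d ?N * (\<Prod>p<Suc k. ?d + fps_X ^ (?N + p))"
    unfolding wprod_add by (subst prod.lessThan_Suc_shift) (simp add: mult_ac)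
  have "pgf d {ys \<in> good r t. length ys = ?N + m} =
      cgf (cparts ColA (?N + Suc k) r t) * wprod d (Suc (?N + k)) -
      cgf (cparts ColA (?N + k) r t) * (?d * wprod d (?N + k))"
    unfolding pgf_good Suc by simp
  also have "\<dots> = cnum r t * inverse (qfac (Suc k)) * wprod d (?N + k) *
      ((?d + fps_X ^ Suc (?N + k)) - ?d * (1 - fps_X ^ Suc k))"
    unfolding cgf_shift q wprod_simps by (simp only: right_diff_distrib mult_ac)
  \<comment> \<open>Here the two terms that are merely multiples of \<open>?d\<close> cancel, which
    leaves the power of \<open>fps_X\<close> that makes the sum over all lengths converge.\<close>
  also have "(?d + fps_X ^ Suc (?N + k)) - ?d * (1 - fps_X ^ Suc k) = fps_X ^ Suc k * (?d + fps_X ^ ?N)"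
    by (simp add: power_add algebra_simps)
  also have "cnum r t * inverse (qfac (Suc k)) * wprod d (?N + k) * (fps_X ^ Suc k * (?d + fps_X ^ ?N)) =
      cnum r t * inverse (qfac (Suc k)) * fps_X ^ Suc k * (wprod d (?N + k) * (?d + fps_X ^ ?N))"
    by (simp only: mult_ac)
  also have "\<dots> = cnum r t * wprod d ?N * (fps_X ^ m * qbin_term d ?N m)"
    unfolding w qbin_term_def Suc by (simp only: mult_ac)
  finally show ?thesis .
qed

lemma pgf_good_cong:
  "fps_X ^ Suc L dvd pgf d (good r t) - cnum r t * wprod d (r + t) * qbin_sum d (r + t) 1 L"
  unfolding fps_X_power_dvd_iff
proof (intro allI impI)
  fix n assume n: "n < Suc L"
  let ?N = "r + t"
  let ?A = "\<lambda>s. {ys \<in> good r t. length ys = s \<and> pweight ys = n}"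
  have len: "?N \<le> length ys" if "ys \<in> good r t" for ys
  proof -
    have "length (filter (\<lambda>x. pcol x = ColA) zs) + length (filter (\<lambda>x. pcol x = ColB) zs) \<le> length zs" for zs
      by (induction zs) auto
    from this[of ys] show ?thesis using that by (auto simp: good_def)
  qed
  \<comment> \<open>\<open>2 * n\<close> bounds all lengths in degree \<open>n\<close>; adding
    \<open>L\<close> ensures \<open>L \<le> M\<close>, so that the two truncations can be
    compared.\<close>
  define M where "M = L + 2 * n"
  have "{ys. ys \<in> good r t \<and> pweight ys = n} = (\<Union>m\<le>M. ?A (?N + m))"
  proof (intro equalityI subsetI)
    fix ys assume ys: "ys \<in> {ys. ys \<in> good r t \<and> pweight ys = n}"
    then have "length ys - ?N \<le> M" "length ys = ?N + (length ys - ?N)"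
      using len[of ys] length_good[of ys r t] by (auto simp: M_def)
    then show "ys \<in> (\<Union>m\<le>M. ?A (?N + m))" using ys by blast
  qed auto
  then have "fps_nth (pgf d (good r t)) n =
      (\<Sum>ys\<in>(\<Union>m\<le>M. ?A (?N + m)). d ^ length (filter (\<lambda>x. \<not> overlined x) ys))"
    by (simp add: pgf_def genfun_nth)
  also have "\<dots> = (\<Sum>m\<le>M. \<Sum>ys\<in>?A (?N + m). d ^ length (filter (\<lambda>x. \<not> overlined x) ys))"
  proof (rule sum.UNION_disjoint)
    show "\<forall>m\<in>{..M}. finite (?A (?N + m))"
      by (intro ballI finite_subset[OF _ finite_part_lists[of "?N + _" n]]) auto
  qed auto
  also have "\<dots> = (\<Sum>m\<le>M. fps_nth (pgf d {ys \<in> good r t. length ys = ?N + m}) n)"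
    by (simp add: pgf_def genfun_nth conj_assoc)
  also have "\<dots> = fps_nth (cnum r t * wprod d ?N * qbin_sum d ?N 1 M) n"
    unfolding pgf_good_shift qbin_sum_def by (simp add: fps_sum_nth sum_distrib_left)
  finally have 1: "fps_nth (pgf d (good r t)) n = fps_nth (cnum r t * wprod d ?N * qbin_sum d ?N 1 M) n" .
  have "fps_X ^ Suc L dvd qbin_sum d ?N 1 M - qbin_sum d ?N 1 L"
  proof -
    have M: "{..M} = {..L} \<union> {L<..M}" by (auto simp: M_def)
    have "qbin_sum d ?N 1 M = qbin_sum d ?N 1 L + (\<Sum>m\<in>{L<..M}. fps_X ^ m * qbin_term d ?N m)"
      unfolding qbin_sum_def M by (subst sum.union_disjoint) auto
    moreover have "fps_X ^ Suc L dvd (\<Sum>m\<in>{L<..M}. fps_X ^ m * qbin_term d ?N m)"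
      by (intro dvd_sum dvd_mult2 le_imp_power_dvd) auto
    ultimately show ?thesis by simp
  qed
  then have "fps_X ^ Suc L dvd cnum r t * wprod d ?N * qbin_sum d ?N 1 M - cnum r t * wprod d ?N * qbin_sum d ?N 1 L"
    unfolding right_diff_distrib[symmetric] by (rule dvd_mult)
  with n show "fps_nth (pgf d (good r t) - cnum r t * wprod d ?N * qbin_sum d ?N 1 L) n = 0"
    unfolding fps_X_power_dvd_iff using 1 by auto
qed

text \<open>The factor \<open>mqfac N\<close> from \<open>cnum\<close> completes the product side of
  the \<open>q\<close>-binomial theorem to \<open>(-q;q)\<close> with infinite index, which no
  longer depends on \<open>N\<close>.\<close>

lemma qbinomial_limit:
  "fps_X ^ n dvd qpoch_inf (fps_const d * fps_X) fps_X * mqfac N * qbin_sum d N 1 n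
     - qpoch_inf (- fps_X) (fps_X :: 'a::field fps)"
proof -
  let ?x = "fps_const d * fps_X :: 'a fps"
  have x: "fps_X dvd ?x" by simp
  have "fps_X ^ n dvd (qpoch ?x fps_X n * qbin_sum d N 1 n) * mqfac N - qpoch (- (fps_X ^ Suc N)) fps_X n * mqfac N"
    using qbinomial_cong[of n d N] by (intro dvd_diff_mult) (auto intro: power_le_dvd)
  moreover have "qpoch (- (fps_X ^ Suc N)) fps_X n * mqfac N = (mqfac (N + n) :: 'a fps)"
    by (simp add: qpoch_add mult.commute)
  moreover have "fps_X ^ n dvd mqfac (N + n) - (mqfac n :: 'a fps)"
    using qpoch_cong[of "- fps_X :: 'a fps" n "N + n"] by (auto intro: power_le_dvd)
  moreover have "fps_X ^ n dvd mqfac n - qpoch_inf (- fps_X) (fps_X :: 'a fps)"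
    using qpoch_inf_cong[of "- fps_X :: 'a fps" n] by (simp add: dvd_diff_commute)
  ultimately have "fps_X ^ n dvd (qpoch ?x fps_X n * qbin_sum d N 1 n) * mqfac N - qpoch_inf (- fps_X) fps_X"
    by (simp only:) (rule dvd_diff_trans, assumption, rule dvd_diff_trans)
  moreover have "fps_X ^ n dvd qpoch_inf ?x fps_X * (mqfac N * qbin_sum d N 1 n) -
      qpoch ?x fps_X n * (mqfac N * qbin_sum d N 1 n)"
    using qpoch_inf_cong[OF x, of n] by (intro dvd_diff_mult) auto
  moreover have "qpoch ?x fps_X n * (mqfac N * qbin_sum d N 1 n) = (qpoch ?x fps_X n * qbin_sum d N 1 n) * mqfac N"
    by (simp only: mult_ac)
  ultimately show ?thesis unfolding mult.assoc[of "qpoch_inf ?x fps_X"]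
    by (simp only:) (rule dvd_diff_trans)
qed

lemma qpoch_inf_nth_0:
  fixes x :: "'a::field fps"
  assumes "fps_X dvd x"
  shows "fps_nth (qpoch_inf x fps_X) 0 = 1"
  using qpoch_inf_cong[OF assms, of 1] qpoch_nth_0[OF assms, of fps_X 1]
  unfolding fps_X_power_dvd_iff by auto

definition rterm :: "'a::field \<Rightarrow> nat \<Rightarrow> nat \<Rightarrow> 'a fps" where
  "rterm d r t = fps_X ^ qexp r t * wprod d (r + t) * inverse (qfac2 r * qfac2 t)"

lemma pgf_good_eq:
  "pgf d (good r t) = qpoch_inf (- fps_X) fps_X / qpoch_inf (fps_const d * fps_X) fps_X * rterm d r t"
proof -
  let ?x = "fps_const d * fps_X :: 'a fps"
  let ?I = "qpoch_inf ?x fps_X"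
  have I: "fps_nth ?I 0 = 1" by (rule qpoch_inf_nth_0) simp
  have "?I * pgf d (good r t) = qpoch_inf (- fps_X) fps_X * rterm d r t"
  proof (rule fps_eqI_cong)
    fix n
    have "fps_X ^ n dvd ?I * pgf d (good r t) - ?I * (cnum r t * wprod d (r + t) * qbin_sum d (r + t) 1 n)"
      using pgf_good_cong[of n d r t] by (intro dvd_diff_mult) (auto intro: power_le_dvd)
    moreover have "?I * (cnum r t * wprod d (r + t) * qbin_sum d (r + t) 1 n) =
        (?I * mqfac (r + t) * qbin_sum d (r + t) 1 n) * rterm d r t"
      by (simp only: cnum_def rterm_def mult_ac)
    moreover have "fps_X ^ n dvd (?I * mqfac (r + t) * qbin_sum d (r + t) 1 n) * rterm d r t -
        qpoch_inf (- fps_X) fps_X * rterm d r t"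
      using qbinomial_limit[of n d "r + t"] by (intro dvd_diff_mult) auto
    ultimately show "fps_X ^ n dvd ?I * pgf d (good r t) - qpoch_inf (- fps_X) fps_X * rterm d r t"
      by (simp only:) (rule dvd_diff_trans)
  qed
  then have "inverse ?I * (?I * pgf d (good r t)) = inverse ?I * (qpoch_inf (- fps_X) fps_X * rterm d r t)"
    by (rule arg_cong)
  then have "(?I * inverse ?I) * pgf d (good r t) = qpoch_inf (- fps_X) fps_X * inverse ?I * rterm d r t"
    by (simp only: mult_ac)
  moreover have "?I * inverse ?I = 1" using I by (intro mult_inverse_eq_1) simp
  ultimately show ?thesis using I by (simp add: fps_divide_unit)
qed

lemma finite_good: "finite {ys \<in> good r t. pweight ys = n}"
proof (rule finite_subset)
  show "{ys \<in> good r t. pweight ys = n} \<subseteq> (\<Union>s\<le>2 * n. {ys. length ys = s \<and> pweight ys = n})"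
    using length_good by fastforce
qed (simp add: finite_part_lists)

section \<open>Assembly of the series in all variables\<close>

lemma C1_eq:
  "C1 n k i j = card {ys \<in> good i j. pweight ys = n \<and> length (filter (\<lambda>x. \<not> overlined x) ys) = k}"
  unfolding C1_def good_def pweight_def by (rule arg_cong[of _ _ card]) auto

lemma C1_nonzeroD:
  assumes "C1 n k i j \<noteq> 0"
  shows "k \<le> 2 * n" "i \<le> 2 * n" "j \<le> 2 * n"
proof -
  obtain ys where ys: "ys \<in> good i j" "pweight ys = n" "length (filter (\<lambda>x. \<not> overlined x) ys) = k"
    using assms unfolding C1_eq by (metis (mono_tags, lifting) card.empty equals0I mem_Collect_eq)
  then have "length ys \<le> 2 * n" using length_good by blast
  then have "length (filter P ys) \<le> 2 * n" for P :: "part \<Rightarrow> bool"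
    using length_filter_le order_trans by blast
  then show "k \<le> 2 * n" "i \<le> 2 * n" "j \<le> 2 * n"
    using ys by (auto simp: good_def)
qed

lemma pgf_good_nth:
  "fps_nth (pgf d (good i j)) n = (\<Sum>k\<le>2 * n. of_nat (C1 n k i j) * d ^ k)"
proof -
  let ?k = "\<lambda>ys. length (filter (\<lambda>x. \<not> overlined x) ys)"
  let ?S = "{ys \<in> good i j. pweight ys = n}"
  have "?k ys \<le> 2 * n" if "ys \<in> ?S" for ys
  proof -
    have "length ys \<le> 2 * n" using that length_good by blast
    then show ?thesis using length_filter_le order_trans by blast
  qed
  then have sub: "?k ` ?S \<subseteq> {..2 * n}" by blast
  have "fps_nth (pgf d (good i j)) n = (\<Sum>ys\<in>?S. d ^ ?k ys)"
    by (simp add: pgf_def genfun_nth)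
  also have "\<dots> = (\<Sum>k\<le>2 * n. \<Sum>ys\<in>{ys \<in> ?S. ?k ys = k}. d ^ ?k ys)"
    by (rule sum.group[symmetric, OF finite_good _ sub]) simp
  also have "\<dots> = (\<Sum>k\<le>2 * n. of_nat (C1 n k i j) * d ^ k)"
    by (intro sum.cong refl) (simp add: C1_eq conj_assoc)
  finally show ?thesis .
qed

lemma rterm_nth_eq_0:
  assumes "2 * n < r + t"
  shows "fps_nth (rterm d r t) n = 0"
proof -
  have "n < qexp r t" using qexp_ge[of r t] assms by linarith
  moreover have "rterm d r t = fps_X ^ qexp r t * (wprod d (r + t) * inverse (qfac2 r * qfac2 t))"
    by (simp add: rterm_def mult.assoc)
  ultimately show ?thesis by (simp add: fps_X_power_mult_nth)
qed

lemma fps_nth_const_mult_monom: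
  "fps_nth (fps_const c * fps_X ^ m) n = (if m = n then c else (0 :: 'a::comm_ring_1))"
  by (simp add: fps_X_power_nth)

text \<open>Summability is checked degree by degree; \<open>B n\<close> may be any finite set
  containing the support in degree \<open>n\<close>.\<close>

lemma has_sum_fps_supersetI:
  assumes "\<And>n. finite (B n)" "\<And>n x. x \<notin> B n \<Longrightarrow> fps_nth (F x) n = 0"
    "\<And>n. fps_nth S n = (\<Sum>x\<in>B n. fps_nth (F x) n)"
  shows "(F has_sum S) UNIV"
proof (rule has_sum_fpsI)
  fix n
  have sub: "{x \<in> UNIV. fps_nth (F x) n \<noteq> 0} \<subseteq> B n" using assms(2) by blast
  then show "finite {x \<in> UNIV. fps_nth (F x) n \<noteq> 0}" using assms(1) finite_subset by blast
  show "fps_nth S n = (\<Sum>x | x \<in> UNIV \<and> fps_nth (F x) n \<noteq> 0. fps_nth (F x) n)"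
    unfolding assms(3) by (rule sum.mono_neutral_right[OF assms(1) sub]) auto
qed

lemma has_sum_rterm:
  "((\<lambda>(r, t). fps_const (a ^ r * b ^ t) * rterm d r t) has_sum
     Abs_fps (\<lambda>n. \<Sum>(r, t)\<in>{..2 * n} \<times> {..2 * n}. a ^ r * b ^ t * fps_nth (rterm d r t) n)) UNIV"
\<comment> \<open>The bound \<open>2 * n\<close> comes from \<open>qexp_ge\<close>.\<close>
proof (rule has_sum_fps_supersetI[where B = "\<lambda>n. {..2 * n} \<times> {..2 * n}"])
  show "fps_nth (case x of (r, t) \<Rightarrow> fps_const (a ^ r * b ^ t) * rterm d r t) n = 0"
    if "x \<notin> {..2 * n} \<times> {..2 * n}" for n x
    using that by (cases x) (auto simp: not_le intro!: rterm_nth_eq_0)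
qed (auto intro!: sum.cong)

lemma overpartition_gf:
  fixes a b d :: "'a::field"
  shows "((\<lambda>(n, k, i, j). fps_const (of_nat (C1 n k i j) * a ^ i * b ^ j * d ^ k) * fps_X ^ n) has_sum
     (qpoch_inf (- fps_X) fps_X / qpoch_inf (fps_const d * fps_X) fps_X *
       (\<Sum>\<^sub>\<infinity>(r, t)\<in>UNIV. fps_const (a ^ r * b ^ t) * rterm d r t))) UNIV"
proof (rule has_sum_fps_supersetI[where B = "\<lambda>n. {n} \<times> {..2 * n} \<times> {..2 * n} \<times> {..2 * n}"])
  let ?F = "\<lambda>(n, k, i, j). fps_const (of_nat (C1 n k i j) * a ^ i * b ^ j * d ^ k) * fps_X ^ n"
  let ?B = "\<lambda>n. {n} \<times> {..2 * n} \<times> {..2 * n} \<times> {..2 * n :: nat}"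
  show "finite (?B n)" for n by simp
  show "fps_nth (?F x) n = 0" if "x \<notin> ?B n" for n x
  proof (cases x)
    case (fields m k i j)
    show ?thesis
    proof (cases "m = n")
      case True
      then have "C1 n k i j = 0" using that C1_nonzeroD[of n k i j] fields by auto
      then show ?thesis using fields True by simp
    qed (use fields in \<open>simp add: fps_nth_const_mult_monom\<close>)
  qed
  fix n :: nat
  let ?R = "qpoch_inf (- fps_X) fps_X / qpoch_inf (fps_const d * fps_X) fps_X"
  let ?I = "{..2 * n} \<times> {..2 * n}"
  define S where "S = (\<Sum>\<^sub>\<infinity>(r, t)\<in>UNIV. fps_const (a ^ r * b ^ t) * rterm d r t)"
  have S: "fps_nth S m = (\<Sum>(r, t)\<in>{..2 * m} \<times> {..2 * m}. a ^ r * b ^ t * fps_nth (rterm d r t) m)" for m :: nat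
    unfolding S_def infsumI[OF has_sum_rterm] by simp
  \<comment> \<open>The index range is enlarged to one that is common to all
    \<open>m \<le> n\<close>, so that the sum over it can be exchanged with the Cauchy
    product.\<close>
  have S': "fps_nth S m = (\<Sum>(r, t)\<in>?I. a ^ r * b ^ t * fps_nth (rterm d r t) m)" if "m \<le> n" for m :: nat
    unfolding S by (rule sum.mono_neutral_left) (use that in \<open>auto intro!: rterm_nth_eq_0\<close>)
  have "fps_nth (?R * S) n = (\<Sum>l=0..n. fps_nth ?R l * (\<Sum>(r, t)\<in>?I. a ^ r * b ^ t * fps_nth (rterm d r t) (n - l)))"
    unfolding fps_mult_nth by (intro sum.cong refl) (simp add: S')
  also have "\<dots> = (\<Sum>(r, t)\<in>?I. a ^ r * b ^ t * (\<Sum>l=0..n. fps_nth ?R l * fps_nth (rterm d r t) (n - l)))"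
    unfolding sum_distrib_left by (subst sum.swap) (simp add: case_prod_unfold mult_ac sum_distrib_left)
  also have "\<dots> = (\<Sum>(r, t)\<in>?I. a ^ r * b ^ t * fps_nth (pgf d (good r t)) n)"
    unfolding pgf_good_eq fps_mult_nth ..
  also have "\<dots> = (\<Sum>(r, t)\<in>?I. \<Sum>k\<le>2 * n. of_nat (C1 n k r t) * a ^ r * b ^ t * d ^ k)"
    unfolding pgf_good_nth by (simp add: sum_distrib_left mult_ac)
  also have "\<dots> = (\<Sum>k\<le>2 * n. \<Sum>(r, t)\<in>?I. of_nat (C1 n k r t) * a ^ r * b ^ t * d ^ k)"
    by (subst sum.swap) (simp add: case_prod_unfold)
  also have "\<dots> = (\<Sum>(k, r, t)\<in>{..2 * n} \<times> ?I. of_nat (C1 n k r t) * a ^ r * b ^ t * d ^ k)"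
    by (simp add: sum.cartesian_product case_prod_unfold)
  also have "\<dots> = (\<Sum>x\<in>?B n. fps_nth (?F x) n)"
    by (rule sum.reindex_bij_witness[of _ snd "Pair n"]) (auto simp: fps_nth_const_mult_monom)
  finally show "fps_nth (?R * S) n = (\<Sum>x\<in>?B n. fps_nth (?F x) n)" .
qed

text \<open>Distributing one factor \<open>d\<close> to each factor of the Pochhammer symbol in
  \<open>-q/d\<close> clears the division and yields \<open>wprod\<close>.\<close>

lemma rterm_eq:
  assumes "d \<noteq> (0 :: 'a::field)"
  shows "fps_X ^ (r\<^sup>2 + r + t\<^sup>2 + t - ((r + t + 1) choose 2)) * fps_const a ^ r * fps_const b ^ t *
      fps_const d ^ (r + t) * qpoch (- fps_X / fps_const d) fps_X (r + t) /
      (qpoch (fps_X\<^sup>2) (fps_X\<^sup>2) r * qpoch (fps_X\<^sup>2) (fps_X\<^sup>2) t) =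
    fps_const (a ^ r * b ^ t) * rterm d r t"
proof -
  have w: "fps_const d ^ n * qpoch (- fps_X / fps_const d) fps_X n = wprod d n" for n
  proof (induction n)
    case (Suc n)
    have "fps_const d * (1 - - fps_X / fps_const d * fps_X ^ n) = fps_const d + fps_X ^ Suc n"
      using assms by (simp add: fps_divide_unit fps_const_inverse[symmetric] algebra_simps mult_inverse_eq_1)
    then have "fps_const d ^ n * qpoch (- fps_X / fps_const d) fps_X n *
        (fps_const d * (1 - - fps_X / fps_const d * fps_X ^ n)) = wprod d n * (fps_const d + fps_X ^ Suc n)"
      using Suc.IH by simp
    then show ?case by (simp only: qpoch_Suc power_Suc wprod_simps mult_ac)
  qed simp
  have "fps_nth (qfac2 r * qfac2 t :: 'a fps) 0 \<noteq> 0" by (simp add: qfac2_nth_0)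
  then show ?thesis
    unfolding rterm_def qexp_def[symmetric] w[symmetric]
    by (simp add: fps_divide_unit mult_ac flip: fps_const_power fps_const_mult)
qed

theorem theorem1p5:
  shows "((\<lambda>(n, k, i, j). of_nat (C1 n k i j) * var_a ^ i * var_b ^ j * var_d ^ k * var_q ^ n)
      has_sum
        (qpoch_inf (- var_q) var_q / qpoch_inf (var_d * var_q) var_q *
         (\<Sum>\<^sub>\<infinity>(r, s) \<in> UNIV.
            var_q ^ (r^2 + r + s^2 + s - ((r + s + 1) choose 2)) * var_a ^ r * var_b ^ s *
              var_d ^ (r + s) * qpoch (- var_q / var_d) var_q (r + s) /
            (qpoch (var_q^2) (var_q^2) r * qpoch (var_q^2) (var_q^2) s)))) UNIV"
proof -
  \<comment> \<open>\<open>overpartition_gf\<close> holds over every field; it is applied to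
    iterated Laurent series, where the indeterminate standing for \<open>d\<close> is
    invertible.\<close>
  have X: "(fls_X :: rat fls fls fls) \<noteq> 0" by simp
  have L: "fps_const (of_nat m * a ^ i * b ^ j * d ^ k) * fps_X ^ n =
      of_nat m * fps_const a ^ i * fps_const b ^ j * fps_const d ^ k * (fps_X ^ n :: gf)" for m i j k n a b d
    by (simp add: fps_of_nat flip: fps_const_power fps_const_mult)
  show ?thesis
    unfolding var_a_def var_b_def var_d_def var_q_def rterm_eq[OF X] L[symmetric]
    by (rule overpartition_gf)
qed

end
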